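(* Let $\Lambda\in(\mathbb R_+^\ast)^N$, let $\mathfrak B$ be a nonempty bounded subset of $\mathcal M_d(\mathbb C)^N$, and let $\mathcal A=L^\infty(\mathbb R,\mathfrak B)$. Consider the following statements: (i) $\mu_{\mathrm{HS}}(\Lambda,\mathfrak B)<1$; (ii) $\Sigma_\delta(\Lambda,\mathcal A)$ is exponentially stable in $\mathsf X_p^\delta$ for some $p\in[1,+\infty]$; (iii) $\Sigma_\delta(L,\mathcal A)$ is exponentially stable in $\mathsf X_p^\delta$ for every $L\in V_+(\Lambda)$ and every $p\in[1,+\infty]$. Then (i) $\implies$ (iii) $\implies$ (ii). If moreover $(1,\dots,1)\in V(\Lambda)$, then also (ii) $\implies$ (i), and, for every $p\in[1,+\infty]$, $$\lambda_p(\Lambda,\mathcal A)=\inf\{\nu\in\mathbb R:\mu_{\mathrm{HS}}(\Lambda,\mathfrak B_{-\nu})<1\},$$ where $\mathfrak B_{-\nu}=\{(e^{-\nu\Lambda_1}B_1,\dots,e^{-\nu\Lambda_N}B_N):(B_1,\dots,B_N)\in\mathfrak B\}$.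
   Context: $\mathbb N=\{0,1,2,\dots\}$, $\mathbb R_+^\ast=(0,+\infty)$; $\mathcal M_d(\mathbb C)$ is the set of complex $d\times d$ matrices with a fixed norm $|\cdot|$; $e_1,\dots,e_N$ is the canonical basis of $\mathbb Z^N$; $L_{\max}$ is the largest component of $L$. Convention $\ln0=-\infty$. Products $\prod_{k=1}^nX_k=X_1\cdots X_n$ are ordered. $L^\infty(\mathbb R,\mathfrak B)$ is the set of measurable functions from $\mathbb R$ to $\mathfrak B$. $Z(\Lambda)=\{\mathbf n\in\mathbb Z^N:\Lambda\cdot\mathbf n=0\}$; $V(\Lambda)=\{L\in\mathbb R^N:Z(\Lambda)\subset Z(L)\}$; $V_+(\Lambda)=V(\Lambda)\cap(\mathbb R_+^\ast)^N$; $\widetilde V(\Lambda)$ is the image of $V(\Lambda)$ under the canonical projection $\mathbb R^N\to(\mathbb R/2\pi\mathbb Z)^N$. For $L\in(\mathbb R_+^\ast)^N$ and $A=(A_1,\dots,A_N)$, $\Sigma_\delta(L,A)$ is the difference equation $u(t)=\sum_{j=1}^NA_j(t)u(t-L_j)$, $t\ge0$, $u(t)\in\mathbb C^d$, with initial condition $u=u_0$ on $[-L_{\max},0)$; $\mathsf X_p^\delta=L^p([-L_{\max},0],\mathbb C^d)$ with its usual norm $\|\cdot\|_p$; $u_t=u(\cdot+t)|_{[-L_{\max},0)}$. The family $\Sigma_\delta(L,\mathcal A)=\{\Sigma_\delta(L,A)\}_{A\in\mathcal A}$ is of exponential type $\gamma\in\mathbb R$ in $\mathsf X_p^\delta$ if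 for every $\varepsilon>0$ there is $K>0$ such that $\|u_t\|_p\le Ke^{(\gamma+\varepsilon)t}\|u_0\|_p$ for all $A\in\mathcal A$, $u_0\in\mathsf X_p^\delta$, $t\ge0$; it is exponentially stable in $\mathsf X_p^\delta$ if it is of exponential type $\gamma$ for some $\gamma<0$. $\lambda_p(L,\mathcal A)=\limsup_{t\to+\infty}\sup_{A\in\mathcal A}\sup_{\|u_0\|_p=1}\frac{\ln\|u_t\|_p}{t}$. For $v=(v_1,\dots,v_n)\in\{1,\dots,N\}^n$, $\mathbf p_v(k)=\sum_{j=1}^{k-1}e_{v_j}$. $\mathcal L(\Lambda)=\{\Lambda\cdot\mathbf n:\mathbf n\in\mathbb N^N\}$, $\mathcal L_x(\Lambda)=\mathcal L(\Lambda)\cap[0,x)$. Then $$\mu_{\mathrm{HS}}(\Lambda,\mathfrak B)=\limsup_{n\to+\infty}\ \sup_{(\theta_1,\dots,\theta_N)\in\widetilde V(\Lambda)}\ \sup_{\substack{B^r\in\mathfrak B\\ \text{for }r\in\mathcal L_{n\Lambda_{\max}}(\Lambda)}}\Bigg|\sum_{v\in\{1,\dots,N\}^n}\prod_{k=1}^nB_{v_k}^{\Lambda\cdot\mathbf p_v(k)}e^{i\theta_{v_k}}\Bigg|^{1/n},$$ where the last supremum is over all families $(B^r)_{r\in\mathcal L_{n\Lambda_{\max}}(\Lambda)}$ of elements $B^r=(B^r_1,\dots,B^r_N)\in\mathfrak B$. *)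

theory Defs
  imports "HOL-Analysis.Analysis" "HOL-Probability.Essential_Supremum" "HOL-Library.Real_Mod"
begin

text \<open>
  \<open>N = CARD('n)\<close> is the number of delays and \<open>d = CARD('d)\<close> the dimension of the state space;
  elements of \<open>M\<^sub>d(\<complex>)\<^sup>N\<close> have type \<open>complex^'d^'d^'n\<close>.
\<close>

section \<open>Matrices\<close>

definition mscale :: "complex \<Rightarrow> complex^'d^'d \<Rightarrow> complex^'d^'d" where
  "mscale c X = (\<chi> i j. c * X $ i $ j)"

text \<open>The norm on \<open>M\<^sub>d(\<complex>)\<close> is arbitrary; in particular it need not be submultiplicative.\<close>

definition is_matrix_norm :: "(complex^'d^'d \<Rightarrow> real) \<Rightarrow> bool" where
  "is_matrix_norm nrm \<longleftrightarrow>
     (\<forall>X. 0 \<le> nrm X) \<and>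
     (\<forall>X. nrm X = 0 \<longleftrightarrow> X = 0) \<and>
     (\<forall>c X. nrm (mscale c X) = cmod c * nrm X) \<and>
     (\<forall>X Y. nrm (X + Y) \<le> nrm X + nrm Y)"

definition ordered_prod :: "nat \<Rightarrow> (nat \<Rightarrow> complex^'d^'d) \<Rightarrow> complex^'d^'d" where
  "ordered_prod n X = foldr (**) (map X [1..<Suc n]) (mat 1)"

section \<open>Delay vectors and rational dependence\<close>

definition vmax :: "real^'n \<Rightarrow> real" where
  "vmax L = Max (range (($) L))"

definition zdot :: "real^'n \<Rightarrow> int^'n \<Rightarrow> real" where
  "zdot L m = (\<Sum>j\<in>UNIV. L $ j * of_int (m $ j))"

definition Zset :: "real^'n \<Rightarrow> (int^'n) set" where
  "Zset L = {m. zdot L m = 0}"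

definition Vset :: "real^'n \<Rightarrow> (real^'n) set" where
  "Vset \<Lambda> = {L. Zset \<Lambda> \<subseteq> Zset L}"

definition Vplus :: "real^'n \<Rightarrow> (real^'n) set" where
  "Vplus \<Lambda> = Vset \<Lambda> \<inter> {L. \<forall>j. 0 < L $ j}"

text \<open>
  The image of \<open>V(\<Lambda>)\<close> in the torus \<open>(\<real>/2\<pi>\<int>)\<^sup>N\<close>, represented by its full preimage in \<open>\<real>\<^sup>N\<close>,
  i.e. the set of all representatives of its points.
\<close>

definition Vtilde :: "real^'n \<Rightarrow> (real^'n) set" where
  "Vtilde \<Lambda> = {\<theta>. \<exists>L\<in>Vset \<Lambda>. \<forall>j. [\<theta> $ j = L $ j] (rmod (2 * pi))}"

definition Lcal :: "real^'n \<Rightarrow> real set" where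
  "Lcal \<Lambda> = {zdot \<Lambda> m | m. \<forall>j. 0 \<le> m $ j}"

definition Lcal_below :: "real^'n \<Rightarrow> real \<Rightarrow> real set" where
  "Lcal_below \<Lambda> x = Lcal \<Lambda> \<inter> {0..<x}"

section \<open>The quantity \<open>\<mu>\<^sub>H\<^sub>S\<close>\<close>

text \<open>A word \<open>v \<in> {1,\<dots>,N}\<^sup>n\<close> is an (extensional) function on the positions \<open>{1..n}\<close>.\<close>

definition pvec :: "(nat \<Rightarrow> 'n) \<Rightarrow> nat \<Rightarrow> int^'n" where
  "pvec v k = (\<Sum>j\<in>{1..<k}. axis (v j) 1)"

definition HS_sum ::
  "real^'n \<Rightarrow> real^'n \<Rightarrow> (real \<Rightarrow> complex^'d^'d^'n) \<Rightarrow> nat \<Rightarrow> complex^'d^'d" where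
  "HS_sum \<Lambda> \<theta> B n =
     (\<Sum>v\<in>{1..n} \<rightarrow>\<^sub>E UNIV.
        ordered_prod n (\<lambda>k. mscale (cis (\<theta> $ v k)) (B (zdot \<Lambda> (pvec v k)) $ v k)))"

definition mu_HS ::
  "(complex^'d^'d \<Rightarrow> real) \<Rightarrow> real^'n \<Rightarrow> (complex^'d^'d^'n) set \<Rightarrow> ereal" where
  "mu_HS nrm \<Lambda> \<BB> =
     limsup (\<lambda>n. SUP \<theta>\<in>Vtilde \<Lambda>. SUP B\<in>Lcal_below \<Lambda> (real n * vmax \<Lambda>) \<rightarrow>\<^sub>E \<BB>.
       ereal (root n (nrm (HS_sum \<Lambda> \<theta> B n))))"

definition shifted :: "real^'n \<Rightarrow> real \<Rightarrow> (complex^'d^'d^'n) set \<Rightarrow> (complex^'d^'d^'n) set" where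
  "shifted \<Lambda> \<nu> \<BB> = (\<lambda>B. \<chi> j. exp (- \<nu> * \<Lambda> $ j) *\<^sub>R B $ j) ` \<BB>"

section \<open>The difference equation\<close>

definition Linf_valued :: "(complex^'d^'d^'n) set \<Rightarrow> (real \<Rightarrow> complex^'d^'d^'n) set" where
  "Linf_valued \<BB> = {A. A \<in> borel_measurable lebesgue \<and> (\<forall>t. A t \<in> \<BB>)}"

text \<open>
  Functions on \<open>[-L\<^sub>m\<^sub>a\<^sub>x, \<infinity>)\<close> and on \<open>[-L\<^sub>m\<^sub>a\<^sub>x, 0)\<close> are total functions whose values elsewhere are
  irrelevant.  By the lemma below, a solution exists and is unique for every initial condition.
\<close>

definition is_solution ::
  "real^'n \<Rightarrow> (real \<Rightarrow> complex^'d^'d^'n) \<Rightarrow> (real \<Rightarrow> complex^'d) \<Rightarrow> (real \<Rightarrow> complex^'d) \<Rightarrow> bool" where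
  "is_solution L A u0 u \<longleftrightarrow>
     (\<forall>t\<ge>0. u t = (\<Sum>j\<in>UNIV. (A t $ j) *v u (t - L $ j))) \<and>
     (\<forall>t\<in>{- vmax L..<0}. u t = u0 t)"

lemma solution_exists_unique:
  fixes L :: "real^'n"
  assumes pos: "\<And>j. 0 < L $ j"
  shows "\<exists>u. is_solution L A u0 u \<and> (\<forall>w. is_solution L A u0 w \<longrightarrow> (\<forall>t\<ge>- vmax L. w t = u t))"
proof -
  define m where "m = Min (range (($) L))"
  have m0: "0 < m" unfolding m_def by (subst Min_gr_iff) (auto simp: pos)
  have mL: "m \<le> L $ j" for j unfolding m_def by (rule Min_le) auto
  have LM: "L $ j \<le> vmax L" for j unfolding vmax_def by (rule Max_ge) auto
  define f where "f = rec_nat u0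
    (\<lambda>_ g t. if t < 0 then u0 t else \<Sum>j\<in>UNIV. (A t $ j) *v g (t - L $ j))"
  have f0: "f 0 = u0" and fS: "f (Suc n) = (\<lambda>t. if t < 0 then u0 t else
      \<Sum>j\<in>UNIV. (A t $ j) *v f n (t - L $ j))" for n
    unfolding f_def by simp_all
  have neg: "t < 0 \<Longrightarrow> f n t = u0 t" for n t by (cases n) (simp_all add: f0 fS)
  have stab: "t < real n * m \<Longrightarrow> n \<le> k \<Longrightarrow> f k t = f n t" for n k t
  proof (induction n arbitrary: k t)
    case 0
    then show ?case by (simp add: neg)
  next
    case (Suc n)
    obtain k' where k: "k = Suc k'" "n \<le> k'" using Suc.prems(2) by (cases k) auto
    have "f k' (t - L $ j) = f n (t - L $ j)" for j
      using Suc.prems(1) mL[of j] by (intro Suc.IH k) (simp add: algebra_simps)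
    then show ?case by (simp add: k fS)
  qed
  define c where "c t = Suc (nat \<lfloor>t / m\<rfloor>)" for t
  have c: "t < real (c t) * m" for t
  proof -
    have "t / m < real (c t)" unfolding c_def by linarith
    then show ?thesis using m0 by (simp add: pos_divide_less_eq)
  qed
  have eq: "f a t = f b t" if "t < real a * m" "t < real b * m" for a b t
    using stab[OF that(1), of b] stab[OF that(2), of a] by (cases "a \<le> b") auto
  define u where "u t = f (c t) t" for t
  have sol: "is_solution L A u0 u"
    unfolding is_solution_def
  proof (intro conjI allI impI ballI)
    fix t :: real assume t: "0 \<le> t"
    have "f (nat \<lfloor>t / m\<rfloor>) (t - L $ j) = u (t - L $ j)" for j
      unfolding u_def using c[of t] mL[of j]
      by (intro eq c) (simp add: c_def algebra_simps)
    then show "u t = (\<Sum>j\<in>UNIV. (A t $ j) *v u (t - L $ j))"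
      using t by (simp add: u_def[of t] c_def fS)
  next
    fix t assume "t \<in> {- vmax L..<0}"
    then show "u t = u0 t" by (simp add: u_def neg)
  qed
  have uniq: "w t = u t" if w: "is_solution L A u0 w" and "- vmax L \<le> t" "t < real n * m" for w t n
    using that(2,3)
  proof (induction n arbitrary: t)
    case 0
    then show ?case using w sol by (simp add: is_solution_def)
  next
    case (Suc n)
    show ?case
    proof (cases "t < 0")
      case True
      then show ?thesis using w sol Suc.prems by (simp add: is_solution_def)
    next
      case False
      have "w (t - L $ j) = u (t - L $ j)" for j
        using Suc.prems False mL[of j] LM[of j] by (intro Suc.IH) (auto simp: algebra_simps)
      then show ?thesis using w sol False by (simp add: is_solution_def)
    qed
  qed
  show ?thesis using sol uniq c by blast
qed

section \<open>The spaces \<open>X\<^sub>p\<close>, exponential stability and Lyapunov exponents\<close>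

definition Lp_norm :: "ennreal \<Rightarrow> 'a measure \<Rightarrow> ('a \<Rightarrow> 'b::real_normed_vector) \<Rightarrow> ennreal" where
  "Lp_norm p M f =
     (if p = \<infinity> then esssup M (\<lambda>x. ennreal (norm (f x)))
      else let I = (\<integral>\<^sup>+x. ennreal (norm (f x) powr enn2real p) \<partial>M)
           in if I = \<infinity> then \<infinity> else ennreal (enn2real I powr (1 / enn2real p)))"

definition Xnorm :: "ennreal \<Rightarrow> real^'n \<Rightarrow> (real \<Rightarrow> complex^'d) \<Rightarrow> ennreal" where
  "Xnorm p L f = Lp_norm p (lebesgue_on {- vmax L..<0}) f"

definition Xspace :: "ennreal \<Rightarrow> real^'n \<Rightarrow> (real \<Rightarrow> complex^'d) set" where
  "Xspace p L = {f. f \<in> borel_measurable (lebesgue_on {- vmax L..<0}) \<and> Xnorm p L f < \<infinity>}"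

definition history :: "(real \<Rightarrow> complex^'d) \<Rightarrow> real \<Rightarrow> real \<Rightarrow> complex^'d" where
  "history u t = (\<lambda>s. u (s + t))"

definition exp_type ::
  "ennreal \<Rightarrow> real^'n \<Rightarrow> (real \<Rightarrow> complex^'d^'d^'n) set \<Rightarrow> real \<Rightarrow> bool" where
  "exp_type p L \<A> \<gamma> \<longleftrightarrow>
     (\<forall>\<epsilon>>0. \<exists>K>0. \<forall>A\<in>\<A>. \<forall>u0\<in>Xspace p L. \<forall>u. is_solution L A u0 u \<longrightarrow>
        (\<forall>t\<ge>0. Xnorm p L (history u t) \<le> ennreal (K * exp ((\<gamma> + \<epsilon>) * t)) * Xnorm p L u0))"

definition exp_stable :: "ennreal \<Rightarrow> real^'n \<Rightarrow> (real \<Rightarrow> complex^'d^'d^'n) set \<Rightarrow> bool" where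
  "exp_stable p L \<A> \<longleftrightarrow> (\<exists>\<gamma><0. exp_type p L \<A> \<gamma>)"

definition ln_ext :: "ennreal \<Rightarrow> ereal" where
  "ln_ext x = (if x = 0 then -\<infinity> else if x = \<infinity> then \<infinity> else ereal (ln (enn2real x)))"

definition lyap_exp :: "ennreal \<Rightarrow> real^'n \<Rightarrow> (real \<Rightarrow> complex^'d^'d^'n) set \<Rightarrow> ereal" where
  "lyap_exp p L \<A> =
     Limsup at_top (\<lambda>t::real. SUP A\<in>\<A>. SUP u\<in>{u. \<exists>u0\<in>Xspace p L. Xnorm p L u0 = 1 \<and> is_solution L A u0 u}.
       ln_ext (Xnorm p L (history u t)) / ereal t)"

end

theory Submission
  imports Defs "HOL-Real_Asymp.Real_Asymp"
begin

text \<open>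
  Unfolding the difference equation writes \<open>u(t)\<close> as a sum over words. Words with the same total delay
  \<open>r = \<Lambda> \<cdot> m\<close> read the initial datum at the same point, also when the delays are replaced by \<open>L \<in> V(\<Lambda>)\<close>, so
  only the grouped coefficients \<open>\<Xi>\<^bsub>n,r\<^esub>\<close> matter. For \<open>\<theta> = s\<Lambda>\<close> the matrix in the definition of \<open>\<mu>\<^sub>H\<^sub>S\<close> is the
  trigonometric polynomial \<open>\<Sum>\<^sub>r e\<^bsup>isr\<^esup> \<Xi>\<^bsub>n,r\<^esub>\<close>; averaging over \<open>s\<close> bounds each \<open>\<Xi>\<^bsub>n,r\<^esub>\<close> by its supremum. Since only
  polynomially many \<open>(n, r)\<close> enter at time \<open>t\<close>, geometric decay of \<open>\<Xi>\<^bsub>n,r\<^esub>\<close> in \<open>n\<close> gives exponential decay of \<open>u\<close>.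
  If \<open>(1,\<dots>,1) \<in> V(\<Lambda>)\<close>, then \<open>r\<close> determines \<open>n\<close>, and \<open>\<Xi>\<^bsub>n,r\<^esub>\<close> is observed as the response at time \<open>r\<close> to an initial
  datum concentrated near \<open>0\<close>, which gives the converse. The factor \<open>exp(-\<nu>\<Lambda>\<^sub>j)\<close> on the \<open>j\<close>-th matrix multiplies
  \<open>\<Xi>\<^bsub>n,r\<^esub>\<close> by \<open>exp(-\<nu>r)\<close>, which turns both directions into the formula for the Lyapunov exponent.
\<close>

section \<open>Matrices\<close>

text \<open>Bilinearity on a finite-dimensional space gives submultiplicativity of
  \<open>norm\<close> up to a constant, and distributivity over finite sums.\<close>

lemma bounded_bilinear_matrix_mult:
  "bounded_bilinear ((**) :: complex^'d^'d \<Rightarrow> complex^'d^'d \<Rightarrow> complex^'d^'d)"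
proof -
  have "bilinear ((**) :: complex^'d^'d \<Rightarrow> complex^'d^'d \<Rightarrow> complex^'d^'d)"
    unfolding bilinear_def
    by (auto intro!: linearI simp: vec_eq_iff matrix_matrix_mult_def algebra_simps sum.distrib scaleR_right.sum)
  then show ?thesis by (simp add: bilinear_conv_bounded_bilinear)
qed

lemma bounded_bilinear_matrix_vector_mult:
  "bounded_bilinear ((*v) :: complex^'d^'d \<Rightarrow> complex^'d \<Rightarrow> complex^'d)"
proof -
  have "bilinear ((*v) :: complex^'d^'d \<Rightarrow> complex^'d \<Rightarrow> complex^'d)"
    unfolding bilinear_def
    by (auto intro!: linearI simp: vec_eq_iff matrix_vector_mult_def algebra_simps sum.distrib scaleR_right.sum)
  then show ?thesis by (simp add: bilinear_conv_bounded_bilinear)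
qed

lemma mscale_add: "mscale c (X + Y) = mscale c X + mscale c Y"
  and mscale_add_left: "mscale (c + d) X = mscale c X + mscale d X"
  and mscale_zero: "mscale c 0 = 0"
  and mscale_zero_left: "mscale 0 X = 0"
  and mscale_one: "mscale 1 X = X"
  and mscale_mscale: "mscale c (mscale d X) = mscale (c * d) X"
  and mscale_of_real: "mscale (complex_of_real a) X = a *\<^sub>R X"
  by (auto simp: mscale_def vec_eq_iff algebra_simps scaleR_conv_of_real[where 'a = complex])

lemma mscale_sum: "mscale c (\<Sum>i\<in>I. X i) = (\<Sum>i\<in>I. mscale c (X i))"
  by (induction I rule: infinite_finite_induct) (simp_all add: mscale_add mscale_zero)

lemma mscale_sum_left: "mscale (\<Sum>i\<in>I. c i) X = (\<Sum>i\<in>I. mscale (c i) X)"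
  by (induction I rule: infinite_finite_induct) (simp_all add: mscale_add_left mscale_zero_left)

lemma mscale_mult_left: "mscale c X ** Y = mscale c (X ** Y)"
  and mscale_mult_right: "X ** mscale c Y = mscale c (X ** Y)"
  by (auto simp: mscale_def vec_eq_iff matrix_matrix_mult_def sum_distrib_left ac_simps)

lemma norm_mscale: "norm (mscale c X) = cmod c * norm X"
  by (simp add: mscale_def norm_vec_def norm_mult L2_set_right_distrib)

text \<open>First half of the equivalence of norms: expand in the canonical basis and use the
  triangle inequality.\<close>

lemma is_matrix_norm_le_norm:
  fixes nrm :: "complex^'d^'d \<Rightarrow> real"
  assumes "is_matrix_norm nrm"
  obtains C where "C > 0" "\<And>X. nrm X \<le> C * norm X"
proof
  have nonneg: "0 \<le> nrm X" and scale: "nrm (a *\<^sub>R X) = \<bar>a\<bar> * nrm X"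
    and tri: "nrm (X + Y) \<le> nrm X + nrm Y" for a X Y
    using assms by (auto simp: is_matrix_norm_def mscale_of_real[symmetric])
  have "nrm 0 = 0" using assms by (auto simp: is_matrix_norm_def)
  then have sum: "nrm (\<Sum>b\<in>I. f b) \<le> (\<Sum>b\<in>I. nrm (f b))" for f :: "complex^'d^'d \<Rightarrow> _" and I
    by (induction I rule: infinite_finite_induct) (auto intro: order_trans[OF tri] add_left_mono)
  show "1 + (\<Sum>b\<in>Basis. nrm b) > 0"
    by (intro add_pos_nonneg sum_nonneg nonneg) auto
  fix X :: "complex^'d^'d"
  have "nrm X = nrm (\<Sum>b\<in>Basis. (X \<bullet> b) *\<^sub>R b)" by (simp add: euclidean_representation)
  also have "\<dots> \<le> (\<Sum>b\<in>Basis. \<bar>X \<bullet> b\<bar> * nrm b)"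
    using sum[of "\<lambda>b. (X \<bullet> b) *\<^sub>R b"] by (simp add: scale)
  also have "\<dots> \<le> (\<Sum>b\<in>Basis. norm X * nrm b)"
    by (intro sum_mono mult_right_mono nonneg Basis_le_norm)
  also have "\<dots> \<le> (1 + (\<Sum>b\<in>Basis. nrm b)) * norm X"
    by (simp add: sum_distrib_left[symmetric] algebra_simps)
  finally show "nrm X \<le> (1 + (\<Sum>b\<in>Basis. nrm b)) * norm X" .
qed

text \<open>Second half: by the first half \<open>nrm\<close> is Lipschitz, so it attains its
  minimum on the compact unit sphere; definiteness makes this minimum positive, and homogeneity does
  the rest.\<close>

lemma norm_le_is_matrix_norm:
  fixes nrm :: "complex^'d^'d \<Rightarrow> real"
  assumes "is_matrix_norm nrm"
  obtains C where "C > 0" "\<And>X. norm X \<le> C * nrm X"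
proof -
  have nonneg: "0 \<le> nrm X" and scale: "nrm (a *\<^sub>R X) = \<bar>a\<bar> * nrm X"
    and zero: "nrm X = 0 \<longleftrightarrow> X = 0" and tri: "nrm (X + Y) \<le> nrm X + nrm Y" for a X Y
    using assms by (auto simp: is_matrix_norm_def mscale_of_real[symmetric])
  obtain D where D: "D > 0" "\<And>X. nrm X \<le> D * norm X" using is_matrix_norm_le_norm[OF assms] by blast
  have lip: "\<bar>nrm X - nrm Y\<bar> \<le> D * norm (X - Y)" for X Y
  proof -
    have "nrm X \<le> nrm (X - Y) + nrm Y" "nrm Y \<le> nrm (Y - X) + nrm X"
      using tri[of "X - Y" Y] tri[of "Y - X" X] by auto
    then show ?thesis using D(2)[of "X - Y"] D(2)[of "Y - X"] by (auto simp: norm_minus_commute)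
  qed
  have "continuous_on (sphere 0 1) nrm"
  proof (rule continuous_onI)
    fix X and e :: real assume "e > 0"
    then show "\<exists>d>0. \<forall>X'\<in>sphere 0 1. dist X' X < d \<longrightarrow> dist (nrm X') (nrm X) \<le> e"
      using D(1)
      by (intro exI[of _ "e / D"])
        (auto simp: dist_norm pos_less_divide_eq mult.commute intro!: order_trans[OF lip])
  qed
  then obtain X0 where X0: "norm X0 = 1" "\<And>X. norm X = 1 \<Longrightarrow> nrm X0 \<le> nrm X"
    using continuous_attains_inf[of "sphere 0 1" nrm] by (auto simp: dist_norm)
  have pos: "nrm X0 > 0" using X0(1) zero[of X0] nonneg[of X0] by (metis less_eq_real_def norm_zero zero_neq_one)
  show thesis
  proof
    show "1 / nrm X0 > 0" using pos by simp
    fix X :: "complex^'d^'d"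
    show "norm X \<le> 1 / nrm X0 * nrm X"
    proof (cases "X = 0")
      case False
      then have "nrm X0 \<le> nrm ((1 / norm X) *\<^sub>R X)" by (intro X0) simp
      then show ?thesis using False pos by (simp add: scale field_simps)
    qed (use nonneg pos in simp)
  qed
qed

lemma ordered_prod_0: "ordered_prod 0 X = mat 1"
  by (simp add: ordered_prod_def)

text \<open>The definition folds from the right. Peeling off the last factor instead matches the
  recursion of \<open>coef\<close>, which splits off the last letter.\<close>

lemma ordered_prod_Suc: "ordered_prod (Suc n) X = ordered_prod n X ** X (Suc n)"
proof -
  have "foldr (**) xs Y = foldr (**) xs (mat 1) ** Y" for xs and Y :: "complex^'d^'d"
    by (induction xs) (simp_all add: matrix_mul_assoc)
  from this[of _ "X (Suc n)"] show ?thesis by (simp add: ordered_prod_def)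
qed

lemma ordered_prod_cong:
  "(\<And>k. 1 \<le> k \<Longrightarrow> k \<le> n \<Longrightarrow> X k = Y k) \<Longrightarrow> ordered_prod n X = ordered_prod n Y"
  by (induction n) (simp_all add: ordered_prod_0 ordered_prod_Suc)

section \<open>Words grouped by their total delay\<close>

text \<open>
  \<open>shell \<Lambda> n\<close> is the set of values \<open>\<Lambda> \<cdot> m\<close> with \<open>m \<in> \<nat>\<^sup>N\<close> and \<open>|m| = n\<close>, and \<open>coef \<Lambda> B n r\<close> is the sum
  of the ordered products \<open>\<Prod>\<^sub>k B\<^bsub>v\<^sub>k\<^esub>(\<Lambda> \<cdot> p\<^sub>v(k))\<close> over the words \<open>v\<close> of length \<open>n\<close> and total delay \<open>r\<close>;
  the recursion splits off the last letter.
\<close>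

primrec shell :: "real^'n \<Rightarrow> nat \<Rightarrow> real set" where
  "shell \<Lambda> 0 = {0}"
| "shell \<Lambda> (Suc n) = (\<Union>j. (\<lambda>r. r + \<Lambda> $ j) ` shell \<Lambda> n)"

primrec coef :: "real^'n \<Rightarrow> (real \<Rightarrow> complex^'d^'d^'n) \<Rightarrow> nat \<Rightarrow> real \<Rightarrow> complex^'d^'d" where
  "coef \<Lambda> B 0 = (\<lambda>r. if r = 0 then mat 1 else 0)"
| "coef \<Lambda> B (Suc n) = (\<lambda>r. \<Sum>j\<in>UNIV. coef \<Lambda> B n (r - \<Lambda> $ j) ** B (r - \<Lambda> $ j) $ j)"

lemma finite_shell [simp]: "finite (shell \<Lambda> n)"
  by (induction n) auto

lemma coef_eq_0: "r \<notin> shell \<Lambda> n \<Longrightarrow> coef \<Lambda> B n r = 0"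
proof (induction n arbitrary: r)
  case (Suc n)
  have "r - \<Lambda> $ j \<notin> shell \<Lambda> n" for j
    using Suc.prems by (force simp: image_iff)
  then show ?case by (simp add: Suc.IH)
qed simp

text \<open>For fixed \<open>j\<close> the summand vanishes off the translate of
  \<open>shell \<Lambda> n\<close> by \<open>\<Lambda> $ j\<close>, so the sum over the larger shell
  reduces to that translate and reindexes.\<close>

lemma sum_shell_Suc:
  fixes \<Lambda> :: "real^'n" and h :: "real \<Rightarrow> 'n \<Rightarrow> 'b::comm_monoid_add"
  assumes "\<And>r j. r \<notin> shell \<Lambda> n \<Longrightarrow> h r j = 0"
  shows "(\<Sum>r\<in>shell \<Lambda> (Suc n). \<Sum>j\<in>UNIV. h (r - \<Lambda> $ j) j) = (\<Sum>r\<in>shell \<Lambda> n. \<Sum>j\<in>UNIV. h r j)"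
proof -
  have "(\<Sum>r\<in>shell \<Lambda> (Suc n). h (r - \<Lambda> $ j) j) = (\<Sum>r\<in>shell \<Lambda> n. h r j)" for j
  proof -
    have "(\<Sum>r\<in>shell \<Lambda> (Suc n). h (r - \<Lambda> $ j) j) = (\<Sum>r\<in>(\<lambda>r. r + \<Lambda> $ j) ` shell \<Lambda> n. h (r - \<Lambda> $ j) j)"
      by (rule sum.mono_neutral_right) (force intro: assms simp del: shell.simps simp: shell.simps(2) image_iff)+
    then show ?thesis by (simp add: sum.reindex inj_on_def)
  qed
  then show ?thesis by (simp only: sum.swap[where B = UNIV])
qed

text \<open>One step of the word recursion, for an arbitrary additive functional. It serves three
  times: with phases, with delayed values of a solution, and with the selection of a single total
  delay.\<close>

lemma sum_shell_coef_Suc: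
  fixes F :: "real \<Rightarrow> complex^'d^'d \<Rightarrow> 'b::real_vector" and \<Lambda> :: "real^'n"
  assumes "\<And>r. Modules.additive (F r)"
  shows "(\<Sum>r\<in>shell \<Lambda> (Suc n). F r (coef \<Lambda> B (Suc n) r)) =
    (\<Sum>r\<in>shell \<Lambda> n. \<Sum>j\<in>UNIV. F (r + \<Lambda> $ j) (coef \<Lambda> B n r ** B r $ j))"
proof -
  define h where "h r j = F (r + \<Lambda> $ j) (coef \<Lambda> B n r ** B r $ j)" for r j
  have "(\<Sum>r\<in>shell \<Lambda> (Suc n). F r (coef \<Lambda> B (Suc n) r)) = (\<Sum>r\<in>shell \<Lambda> (Suc n). \<Sum>j\<in>UNIV. h (r - \<Lambda> $ j) j)"
    by (intro sum.cong refl) (simp add: h_def Modules.additive.sum[OF assms])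
  also have "\<dots> = (\<Sum>r\<in>shell \<Lambda> n. \<Sum>j\<in>UNIV. h r j)"
    by (rule sum_shell_Suc) (simp add: h_def coef_eq_0 Modules.additive.zero[OF assms])
  finally show ?thesis by (simp add: h_def)
qed

section \<open>Total delays as integer combinations, and regrouping of \<open>HS_sum\<close>\<close>

lemma pvec_1: "pvec v (Suc 0) = 0"
  by (simp add: pvec_def)

lemma pvec_Suc: "pvec v (Suc (Suc n)) = pvec v (Suc n) + axis (v (Suc n)) 1"
  by (simp add: pvec_def)

lemma pvec_cong: "(\<And>i. 1 \<le> i \<Longrightarrow> i < k \<Longrightarrow> v i = w i) \<Longrightarrow> pvec v k = pvec w k"
  by (simp add: pvec_def)

lemma zdot_0: "zdot \<Lambda> 0 = 0"
  by (simp add: zdot_def)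

lemma zdot_add: "zdot \<Lambda> (m + m') = zdot \<Lambda> m + zdot \<Lambda> m'"
  by (simp add: zdot_def algebra_simps sum.distrib)

lemma zdot_diff: "zdot \<Lambda> (m - m') = zdot \<Lambda> m - zdot \<Lambda> m'"
  by (simp add: zdot_def algebra_simps sum_subtractf)

lemma zdot_axis: "zdot \<Lambda> (axis j 1) = \<Lambda> $ j"
proof -
  have "zdot \<Lambda> (axis j 1) = (\<Sum>i\<in>UNIV. if i = j then \<Lambda> $ i else 0)"
    unfolding zdot_def by (intro sum.cong) (auto simp: axis_def)
  then show ?thesis by simp
qed

lemma shell_imp_zdot:
  "r \<in> shell \<Lambda> n \<Longrightarrow> \<exists>m. r = zdot \<Lambda> m \<and> (\<forall>j. 0 \<le> m $ j \<and> m $ j \<le> int n)"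
proof (induction n arbitrary: r)
  case 0
  then show ?case by (intro exI[of _ 0]) (simp add: zdot_0)
next
  case (Suc n)
  then obtain j r' where r': "r = r' + \<Lambda> $ j" "r' \<in> shell \<Lambda> n" by auto
  with Suc.IH obtain m where "r' = zdot \<Lambda> m" "\<forall>i. 0 \<le> m $ i \<and> m $ i \<le> int n" by blast
  then show ?case using r'
    by (intro exI[of _ "m + axis j 1"]) (auto simp: zdot_add zdot_axis; force simp: axis_def intro: order_trans[of _ "int n"])
qed

text \<open>Total delays come from integer vectors with entries in \<open>{0..n}\<close>. There are
  only polynomially many of these, although the number of words can grow exponentially.\<close>

lemma card_shell_le: "card (shell (\<Lambda> :: real^'n) n) \<le> Suc n ^ CARD('n)"
proof -
  let ?F = "(UNIV :: 'n set) \<rightarrow>\<^sub>E {0..int n}"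
  have "shell \<Lambda> n \<subseteq> (\<lambda>f. zdot \<Lambda> (\<chi> j. f j)) ` ?F"
  proof
    fix r assume "r \<in> shell \<Lambda> n"
    then obtain m where "r = zdot \<Lambda> m" "\<forall>j. 0 \<le> m $ j \<and> m $ j \<le> int n" using shell_imp_zdot by blast
    then show "r \<in> (\<lambda>f. zdot \<Lambda> (\<chi> j. f j)) ` ?F"
      by (intro image_eqI[of _ _ "\<lambda>j. m $ j"]) (auto simp: vec_lambda_eta)
  qed
  then have "card (shell \<Lambda> n) \<le> card ?F"
    by (intro surj_card_le) (auto intro: finite_PiE)
  then show ?thesis by (simp add: card_PiE nat_add_distrib)
qed

lemma pvec_mem_shell: "zdot \<Lambda> (pvec v (Suc n)) \<in> shell \<Lambda> n"
  by (induction n) (auto simp: pvec_1 pvec_Suc zdot_0 zdot_add zdot_axis)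

lemma sum_PiE_Suc:
  fixes f :: "(nat \<Rightarrow> 'n::finite) \<Rightarrow> 'b::comm_monoid_add"
  shows "(\<Sum>v\<in>{1..Suc n} \<rightarrow>\<^sub>E UNIV. f v) = (\<Sum>v\<in>{1..n} \<rightarrow>\<^sub>E UNIV. \<Sum>j\<in>UNIV. f (v(Suc n := j)))"
proof -
  have "{1..Suc n} \<rightarrow>\<^sub>E (UNIV :: 'n set) = (\<lambda>(j, v). v(Suc n := j)) ` (UNIV \<times> ({1..n} \<rightarrow>\<^sub>E UNIV))"
    by (simp add: atLeastAtMostSuc_conv PiE_insert_eq)
  moreover have "inj_on (\<lambda>(j, v). v(Suc n := j)) (UNIV \<times> ({1..n} \<rightarrow>\<^sub>E (UNIV :: 'n set)))"
    using inj_combinator[of "Suc n" "{1..n}" "\<lambda>_. UNIV :: 'n set"] by simp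
  ultimately have "(\<Sum>v\<in>{1..Suc n} \<rightarrow>\<^sub>E UNIV. f v) = (\<Sum>(j, v)\<in>UNIV \<times> ({1..n} \<rightarrow>\<^sub>E UNIV). f (v(Suc n := j)))"
    by (simp add: sum.reindex case_prod_unfold)
  then show ?thesis
    by (simp add: sum.cartesian_product[symmetric] sum.swap[of _ UNIV])
qed

text \<open>The phase of a word depends only on its total delay, through \<open>f\<close>. The
  factor \<open>G\<close> at the right end makes the induction go through: the last letter of a word
  is absorbed into a new \<open>G\<close>.\<close>

lemma HS_sum_mult_eq:
  fixes \<Lambda> \<theta> :: "real^'n" and B :: "real \<Rightarrow> complex^'d^'d^'n"
  assumes f0: "f 0 = 1" and f: "\<And>r j k. r \<in> shell \<Lambda> k \<Longrightarrow> f (r + \<Lambda> $ j) = f r * cis (\<theta> $ j)"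
  shows "(\<Sum>v\<in>{1..n} \<rightarrow>\<^sub>E UNIV.
      ordered_prod n (\<lambda>k. mscale (cis (\<theta> $ v k)) (B (zdot \<Lambda> (pvec v k)) $ v k)) ** G (zdot \<Lambda> (pvec v (Suc n))))
    = (\<Sum>r\<in>shell \<Lambda> n. mscale (f r) (coef \<Lambda> B n r ** G r))"
proof (induction n arbitrary: G)
  case 0
  then show ?case by (simp add: ordered_prod_0 pvec_1 zdot_0 f0 mscale_one)
next
  case (Suc n)
  interpret M: bounded_bilinear "(**) :: complex^'d^'d \<Rightarrow> complex^'d^'d \<Rightarrow> complex^'d^'d"
    by (rule bounded_bilinear_matrix_mult)
  define P where "P m v = ordered_prod m (\<lambda>k. mscale (cis (\<theta> $ v k)) (B (zdot \<Lambda> (pvec v k)) $ v k))" for m v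
  \<comment> \<open>The sum over all last letters that can follow a prefix of total delay
    \<open>r\<close>.\<close>
  define G' where "G' r = (\<Sum>j\<in>UNIV. mscale (cis (\<theta> $ j)) (B r $ j) ** G (r + \<Lambda> $ j))" for r
  have upd: "pvec (v(Suc n := j)) k = pvec v k" if "k \<le> Suc n" for v j k
    using that by (intro pvec_cong) auto
  have Pupd: "P n (v(Suc n := j)) = P n v" for v j
    unfolding P_def by (intro ordered_prod_cong) (simp add: upd)
  have "(\<Sum>v\<in>{1..Suc n} \<rightarrow>\<^sub>E UNIV. P (Suc n) v ** G (zdot \<Lambda> (pvec v (Suc (Suc n))))) =
     (\<Sum>v\<in>{1..n} \<rightarrow>\<^sub>E UNIV. \<Sum>j\<in>UNIV. P n v ** (mscale (cis (\<theta> $ j)) (B (zdot \<Lambda> (pvec v (Suc n))) $ j)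
        ** G (zdot \<Lambda> (pvec v (Suc n)) + \<Lambda> $ j)))"
  proof -
    have "P (Suc n) (v(Suc n := j)) = P n v ** mscale (cis (\<theta> $ j)) (B (zdot \<Lambda> (pvec v (Suc n))) $ j)" for v j
      using Pupd[of v j] by (simp add: P_def ordered_prod_Suc upd)
    then show ?thesis
      unfolding sum_PiE_Suc by (simp add: pvec_Suc upd zdot_add zdot_axis matrix_mul_assoc)
  qed
  also have "\<dots> = (\<Sum>v\<in>{1..n} \<rightarrow>\<^sub>E UNIV. P n v ** G' (zdot \<Lambda> (pvec v (Suc n))))"
    by (simp add: G'_def M.sum_right)
  also have "\<dots> = (\<Sum>r\<in>shell \<Lambda> n. mscale (f r) (coef \<Lambda> B n r ** G' r))"
    unfolding P_def by (rule Suc.IH)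
  also have "\<dots> = (\<Sum>r\<in>shell \<Lambda> n. \<Sum>j\<in>UNIV. mscale (f (r + \<Lambda> $ j)) (coef \<Lambda> B n r ** B r $ j ** G (r + \<Lambda> $ j)))"
    by (intro sum.cong refl)
      (simp add: G'_def M.sum_right mscale_sum f mscale_mscale mscale_mult_left mscale_mult_right matrix_mul_assoc)
  also have "\<dots> = (\<Sum>r\<in>shell \<Lambda> (Suc n). mscale (f r) (coef \<Lambda> B (Suc n) r ** G r))"
    by (rule sum_shell_coef_Suc[symmetric, where F = "\<lambda>r X. mscale (f r) (X ** G r)"])
      (simp add: Modules.additive_def M.add_left mscale_add)
  finally show ?case by (simp add: P_def)
qed

lemma HS_sum_eq_sum_coef:
  fixes \<Lambda> \<theta> :: "real^'n" and B :: "real \<Rightarrow> complex^'d^'d^'n"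
  assumes "f 0 = 1" and "\<And>r j k. r \<in> shell \<Lambda> k \<Longrightarrow> f (r + \<Lambda> $ j) = f r * cis (\<theta> $ j)"
  shows "HS_sum \<Lambda> \<theta> B n = (\<Sum>r\<in>shell \<Lambda> n. mscale (f r) (coef \<Lambda> B n r))"
  using HS_sum_mult_eq[OF assms, where G = "\<lambda>_. mat 1"] by (simp add: HS_sum_def)

text \<open>
  A coefficient of a trigonometric polynomial is the mean of the polynomial against the conjugate
  character; sampling at multiples of a small step \<open>h\<close> turns the mean into geometric sums.
\<close>

lemma norm_le_of_trig_sum_bound:
  fixes Y :: "real \<Rightarrow> complex^'d^'d"
  assumes S: "finite S" "r0 \<in> S"
    and M: "\<And>s. norm (\<Sum>r\<in>S. mscale (cis (s * r)) (Y r)) \<le> M"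
  shows "norm (Y r0) \<le> M"
proof -
  \<comment> \<open>The step is so small that every angle \<open>h * (r - r0)\<close> has modulus
    below \<open>pi\<close>; hence \<open>z r = 1\<close> only for \<open>r = r0\<close>.\<close>
  define h where "h = pi / (1 + (\<Sum>r\<in>S. \<bar>r - r0\<bar>))"
  define z where "z r = cis (h * (r - r0))" for r
  have den: "0 < 1 + (\<Sum>r\<in>S. \<bar>r - r0\<bar>)" by (intro add_pos_nonneg sum_nonneg) auto
  have z: "z r \<noteq> 1" if r: "r \<in> S - {r0}" for r
  proof
    assume "z r = 1"
    have "\<bar>r - r0\<bar> < 1 + (\<Sum>r\<in>S. \<bar>r - r0\<bar>)"
      using member_le_sum[of r S "\<lambda>r. \<bar>r - r0\<bar>"] r S by auto
    then have "\<bar>h * (r - r0)\<bar> < pi"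
      using den by (simp add: h_def abs_mult pos_divide_less_eq)
    moreover have "h * (r - r0) \<noteq> 0" using r den by (auto simp: h_def)
    moreover have "cos (h * (r - r0)) = 1" using \<open>z r = 1\<close> by (simp add: z_def complex_eq_iff)
    ultimately show False
      using cos_monotone_0_pi[of 0 "\<bar>h * (r - r0)\<bar>"] by (simp)
  qed
  \<comment> \<open>Bounds the geometric sums of all other frequencies independently of the number
    \<open>K\<close> of samples, since \<open>z r\<close> has modulus 1.\<close>
  define E where "E = (\<Sum>r\<in>S - {r0}. 2 / cmod (1 - z r) * norm (Y r))"
  have K: "real K * norm (Y r0) \<le> real K * M + E" for K :: nat
  proof -
    \<comment> \<open>The sample at frequency \<open>m * h\<close>, rotated so that the term of
      \<open>r0\<close> no longer depends on \<open>m\<close>.\<close>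
    define g where "g m = mscale (cis (- (real m * h * r0))) (\<Sum>r\<in>S. mscale (cis (real m * h * r)) (Y r))" for m
    have g: "g m = Y r0 + (\<Sum>r\<in>S - {r0}. mscale (z r ^ m) (Y r))" for m
    proof -
      have "g m = (\<Sum>r\<in>S. mscale (z r ^ m) (Y r))"
        unfolding g_def mscale_sum mscale_mscale cis_mult z_def Complex.DeMoivre by (simp add: algebra_simps)
      also have "\<dots> = mscale (z r0 ^ m) (Y r0) + (\<Sum>r\<in>S - {r0}. mscale (z r ^ m) (Y r))"
        by (rule sum.remove[OF S])
      finally show ?thesis by (simp add: z_def mscale_one)
    qed
    have "(\<Sum>m<K. g m) = real K *\<^sub>R Y r0 + (\<Sum>r\<in>S - {r0}. mscale (\<Sum>m<K. z r ^ m) (Y r))"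
      by (simp add: g sum.distrib sum.swap[of _ "S - {r0}"] mscale_sum_left sum_constant_scaleR del: sum_constant)
    then have "real K *\<^sub>R Y r0 = (\<Sum>m<K. g m) - (\<Sum>r\<in>S - {r0}. mscale (\<Sum>m<K. z r ^ m) (Y r))"
      by simp
    then have "real K * norm (Y r0) = norm ((\<Sum>m<K. g m) - (\<Sum>r\<in>S - {r0}. mscale (\<Sum>m<K. z r ^ m) (Y r)))"
      by (metis abs_of_nat norm_scaleR)
    also have "\<dots> \<le> norm (\<Sum>m<K. g m) + norm (\<Sum>r\<in>S - {r0}. mscale (\<Sum>m<K. z r ^ m) (Y r))"
      by (rule norm_triangle_ineq4)
    also have "norm (\<Sum>m<K. g m) \<le> (\<Sum>m<K. M)"
      by (intro order_trans[OF norm_sum] sum_mono) (simp add: g_def norm_mscale M)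
    also have "norm (\<Sum>r\<in>S - {r0}. mscale (\<Sum>m<K. z r ^ m) (Y r)) \<le> E"
      unfolding E_def
    proof (intro order_trans[OF norm_sum] sum_mono)
      fix r assume "r \<in> S - {r0}"
      then have "(\<Sum>m<K. z r ^ m) = (1 - z r ^ K) / (1 - z r)" using z by (simp add: sum_gp_strict)
      moreover have "cmod (1 - z r ^ K) \<le> 2"
        using norm_triangle_ineq4[of 1 "z r ^ K"] by (simp add: z_def norm_power)
      ultimately show "norm (mscale (\<Sum>m<K. z r ^ m) (Y r)) \<le> 2 / cmod (1 - z r) * norm (Y r)"
        by (auto simp: norm_mscale norm_divide intro!: mult_right_mono divide_right_mono)
    qed
    finally show ?thesis by simp
  qed
  \<comment> \<open>Dividing by \<open>K\<close> and letting \<open>K\<close> grow removes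
    \<open>E\<close>; the Archimedean property replaces the limit.\<close>
  show ?thesis
  proof (rule ccontr)
    assume "\<not> norm (Y r0) \<le> M"
    then obtain K :: nat where "E < real K * (norm (Y r0) - M)"
      using reals_Archimedean3[of "norm (Y r0) - M"] by auto
    with K[of K] show False by (simp add: algebra_simps)
  qed
qed

section \<open>Extreme delays and the change of delay vector\<close>

definition vmin :: "real^'n \<Rightarrow> real" where
  "vmin L = Min (range (($) L))"

lemma le_vmax: "L $ j \<le> vmax L"
  unfolding vmax_def by (rule Max_ge) auto

lemma vmin_le: "vmin L \<le> L $ j"
  unfolding vmin_def by (rule Min_le) auto

lemma vmin_pos: "(\<And>j. 0 < L $ j) \<Longrightarrow> 0 < vmin L"
  unfolding vmin_def by (subst Min_gr_iff) auto

lemma vmax_pos: "(\<And>j. 0 < L $ j) \<Longrightarrow> 0 < vmax L"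
  by (rule less_le_trans[OF _ le_vmax])

text \<open>
  Commensurabilities of \<open>\<Lambda>\<close> are inherited by \<open>L \<in> V(\<Lambda>)\<close>, so that \<open>\<Lambda> \<cdot> m \<mapsto> L \<cdot> m\<close> is well defined.
\<close>

definition transfer :: "real^'n \<Rightarrow> real^'n \<Rightarrow> real \<Rightarrow> real" where
  "transfer \<Lambda> L r = zdot L (SOME m. zdot \<Lambda> m = r)"

lemma transfer_zdot:
  assumes "L \<in> Vset \<Lambda>"
  shows "transfer \<Lambda> L (zdot \<Lambda> m) = zdot L m"
proof -
  define m' where "m' = (SOME m'. zdot \<Lambda> m' = zdot \<Lambda> m)"
  have "zdot \<Lambda> m' = zdot \<Lambda> m" unfolding m'_def by (rule someI_ex) blast
  then have "m' - m \<in> Zset \<Lambda>" by (simp add: Zset_def zdot_diff)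
  then have "m' - m \<in> Zset L" using assms by (auto simp: Vset_def)
  then show ?thesis by (simp add: transfer_def m'_def[symmetric] Zset_def zdot_diff)
qed

lemma transfer_0: "L \<in> Vset \<Lambda> \<Longrightarrow> transfer \<Lambda> L 0 = 0"
  using transfer_zdot[of L \<Lambda> 0] by (simp add: zdot_0)

lemma transfer_add:
  assumes "L \<in> Vset \<Lambda>" "r \<in> shell \<Lambda> n"
  shows "transfer \<Lambda> L (r + \<Lambda> $ j) = transfer \<Lambda> L r + L $ j"
proof -
  obtain m where r: "r = zdot \<Lambda> m" using shell_imp_zdot[OF assms(2)] by blast
  have "r + \<Lambda> $ j = zdot \<Lambda> (m + axis j 1)" by (simp add: r zdot_add zdot_axis)
  then have "transfer \<Lambda> L (r + \<Lambda> $ j) = zdot L (m + axis j 1)" by (simp only: transfer_zdot[OF assms(1)])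
  then show ?thesis by (simp add: r transfer_zdot[OF assms(1)] zdot_add zdot_axis)
qed

lemma transfer_mem_shell: "L \<in> Vset \<Lambda> \<Longrightarrow> r \<in> shell \<Lambda> n \<Longrightarrow> transfer \<Lambda> L r \<in> shell L n"
  by (induction n arbitrary: r) (force simp: transfer_0 transfer_add)+

lemma self_mem_Vset: "\<Lambda> \<in> Vset \<Lambda>"
  by (simp add: Vset_def)

lemma transfer_self: "r \<in> shell \<Lambda> n \<Longrightarrow> transfer \<Lambda> \<Lambda> r = r"
  by (induction n arbitrary: r) (auto simp: transfer_0[OF self_mem_Vset] transfer_add[OF self_mem_Vset])

lemma shell_ge: "r \<in> shell L n \<Longrightarrow> real n * vmin L \<le> r"
proof (induction n arbitrary: r)
  case (Suc n)
  then obtain j r' where "r = r' + L $ j" "r' \<in> shell L n" by auto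
  then show ?case using Suc.IH[of r'] vmin_le[of L j] by (simp add: algebra_simps)
qed simp

lemma shell_le: "r \<in> shell L n \<Longrightarrow> r \<le> real n * vmax L"
proof (induction n arbitrary: r)
  case (Suc n)
  then obtain j r' where "r = r' + L $ j" "r' \<in> shell L n" by auto
  then show ?case using Suc.IH[of r'] le_vmax[of L j] by (simp add: algebra_simps)
qed simp

lemma shell_nonneg: "(\<And>j. 0 < L $ j) \<Longrightarrow> r \<in> shell L n \<Longrightarrow> 0 \<le> r"
  using shell_ge[of r L n] vmin_pos[of L] by (meson mult_nonneg_nonneg less_imp_le of_nat_0_le_iff order_trans)

text \<open>If \<open>(1,\<dots>,1) \<in> V(\<Lambda>)\<close>, then \<open>\<Lambda> \<cdot> m\<close> determines the length of \<open>m\<close>.\<close>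

lemma shell_disjoint:
  assumes "(\<chi> j. 1) \<in> Vset (\<Lambda> :: real^'n)" "r \<in> shell \<Lambda> n" "r \<in> shell \<Lambda> k"
  shows "n = k"
proof -
  have "shell (\<chi> j. 1 :: real^'n) m = {real m}" for m
    by (induction m) auto
  then show ?thesis
    using transfer_mem_shell[OF assms(1,2)] transfer_mem_shell[OF assms(1,3)] by simp
qed

text \<open>A product of \<open>n\<close> factors reads \<open>B\<close> at total delays of fewer
  than \<open>n\<close> letters. These all lie in the index set of the families in
  \<open>mu_HS\<close>.\<close>

lemma shell_subset_Lcal_below:
  assumes "\<And>j. 0 < \<Lambda> $ j" "k < n"
  shows "shell \<Lambda> k \<subseteq> Lcal_below \<Lambda> (real n * vmax \<Lambda>)"
proof
  fix r assume r: "r \<in> shell \<Lambda> k"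
  have "r \<le> real k * vmax \<Lambda>" by (rule shell_le[OF r])
  also have "\<dots> < real n * vmax \<Lambda>" using assms vmax_pos[of \<Lambda>] by simp
  finally show "r \<in> Lcal_below \<Lambda> (real n * vmax \<Lambda>)"
    using shell_imp_zdot[OF r] shell_nonneg[OF assms(1) r] by (auto simp: Lcal_below_def Lcal_def)
qed

section \<open>Dependence of the sums on the matrices\<close>

lemma HS_sum_cong:
  assumes "\<And>k r. k < n \<Longrightarrow> r \<in> shell \<Lambda> k \<Longrightarrow> B r = B' r"
  shows "HS_sum \<Lambda> \<theta> B n = HS_sum \<Lambda> \<theta> B' n"
  unfolding HS_sum_def
proof (intro sum.cong refl ordered_prod_cong)
  fix v k assume k: "1 \<le> k" "k \<le> n"
  then obtain i where "k = Suc i" by (cases k) auto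
  then have "B (zdot \<Lambda> (pvec v k)) = B' (zdot \<Lambda> (pvec v k))"
    using k by (intro assms[of i]) (auto simp: pvec_mem_shell)
  then show "mscale (cis (\<theta> $ v k)) (B (zdot \<Lambda> (pvec v k)) $ v k) =
    mscale (cis (\<theta> $ v k)) (B' (zdot \<Lambda> (pvec v k)) $ v k)" by simp
qed

lemma coef_cong:
  assumes "\<And>k r. k < n \<Longrightarrow> r \<in> shell \<Lambda> k \<Longrightarrow> B r = B' r"
  shows "coef \<Lambda> B n r = coef \<Lambda> B' n r"
  using assms
proof (induction n arbitrary: r)
  case (Suc n)
  have IH: "coef \<Lambda> B n s = coef \<Lambda> B' n s" for s by (rule Suc) (use Suc.prems less_SucI in blast)
  \<comment> \<open>Off the shell the two families may differ, but there the coefficient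
    vanishes.\<close>
  have "coef \<Lambda> B' n s ** B s $ j = coef \<Lambda> B' n s ** B' s $ j" for s j
    using Suc.prems[of n s] by (cases "s \<in> shell \<Lambda> n") (simp_all add: coef_eq_0)
  then show ?case by (simp add: IH)
qed simp

lemma coef_scale:
  fixes B :: "real \<Rightarrow> complex^'d^'d^'n"
  shows "coef \<Lambda> (\<lambda>r. \<chi> j. exp (- \<nu> * \<Lambda> $ j) *\<^sub>R B r $ j) n r = exp (- \<nu> * r) *\<^sub>R coef \<Lambda> B n r"
proof (induction n arbitrary: r)
  case (Suc n)
  interpret M: bounded_bilinear "(**) :: complex^'d^'d \<Rightarrow> complex^'d^'d \<Rightarrow> complex^'d^'d"
    by (rule bounded_bilinear_matrix_mult)
  have "exp (- \<nu> * \<Lambda> $ j) * exp (- \<nu> * (r - \<Lambda> $ j)) = exp (- \<nu> * r)" for j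
    by (simp add: exp_add[symmetric] algebra_simps)
  then show ?case
    unfolding coef.simps Suc.IH by (simp add: M.scaleR_left M.scaleR_right scaleR_sum_right)
qed simp

text \<open>A crude bound for each \<open>n\<close>, uniform in \<open>B\<close> and
  \<open>r\<close>. It covers the finitely many lengths about which a limsup says nothing.\<close>

lemma bounded_coef:
  fixes \<BB> :: "(complex^'d^'d^'n) set"
  assumes "bounded \<BB>"
  shows "\<exists>c. \<forall>B r. (\<forall>s. B s \<in> \<BB>) \<longrightarrow> norm (coef \<Lambda> B n r) \<le> c"
proof (induction n)
  case 0
  show ?case by (intro exI[of _ "norm (mat 1 :: complex^'d^'d)"]) simp
next
  case (Suc n)
  obtain K where K: "0 < K" "\<forall>(X :: complex^'d^'d) (Y :: complex^'d^'d). norm (X ** Y) \<le> norm X * norm Y * K"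
    using bounded_bilinear.pos_bounded[OF bounded_bilinear_matrix_mult[where 'd = 'd]] by auto
  obtain b where b: "0 < b" "\<And>x. x \<in> \<BB> \<Longrightarrow> norm x \<le> b" using assms by (auto simp: bounded_pos)
  obtain c where c: "\<And>B r. (\<forall>s. B s \<in> \<BB>) \<Longrightarrow> norm (coef \<Lambda> B n r) \<le> c" using Suc.IH by blast
  have "norm (coef \<Lambda> B (Suc n) r) \<le> (\<Sum>j\<in>(UNIV :: 'n set). c * b * K)" if B: "\<forall>s. B s \<in> \<BB>" for B r
    unfolding coef.simps
  proof (intro order_trans[OF norm_sum] sum_mono order_trans[OF K(2)[rule_format]] mult_right_mono mult_mono c[OF B])
    show "norm (B (r - \<Lambda> $ j) $ j) \<le> b" for j
      by (rule order_trans[OF Finite_Cartesian_Product.norm_nth_le b(2)]) (simp add: B)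
    show "0 \<le> c" by (rule order_trans[OF norm_ge_zero c[OF B]])
  qed (use K in auto)
  then show ?case by blast
qed

text \<open>Supplies every frequency \<open>s\<close> needed for the averaging argument.\<close>

lemma scaled_mem_Vtilde: "s *\<^sub>R \<Lambda> \<in> Vtilde \<Lambda>"
proof -
  have "zdot (s *\<^sub>R \<Lambda>) m = s * zdot \<Lambda> m" for m
    by (simp add: zdot_def sum_distrib_left ac_simps)
  then have "s *\<^sub>R \<Lambda> \<in> Vset \<Lambda>" by (auto simp: Vset_def Zset_def)
  then show ?thesis unfolding Vtilde_def by (auto intro!: bexI[of _ "s *\<^sub>R \<Lambda>"])
qed

lemma bounded_shifted:
  fixes \<BB> :: "(complex^'d^'d^'n) set"
  assumes "bounded \<BB>"
  shows "bounded (shifted \<Lambda> \<nu> \<BB>)"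
proof -
  have "linear (\<lambda>B :: complex^'d^'d^'n. \<chi> j. exp (- \<nu> * \<Lambda> $ j) *\<^sub>R B $ j)"
    by (rule linearI) (simp_all add: vec_eq_iff algebra_simps)
  then show ?thesis unfolding shifted_def
    by (intro bounded_linear_image[OF assms]) (simp add: linear_conv_bounded_linear)
qed

section \<open>Growth of the coefficients and \<open>\<mu>\<^sub>H\<^sub>S\<close>\<close>

lemma coef_bound_of_mu_HS:
  fixes \<Lambda> :: "real^'n" and \<BB> :: "(complex^'d^'d^'n) set"
  assumes nrm: "is_matrix_norm nrm" and pos: "\<And>j. 0 < \<Lambda> $ j" and "bounded \<BB>"
    and mu: "mu_HS nrm \<Lambda> (shifted \<Lambda> \<nu> \<BB>) < 1"
  obtains C \<rho> where "0 < C" "0 < \<rho>" "\<rho> < 1"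
    "\<And>B n r. \<forall>s. B s \<in> \<BB> \<Longrightarrow> norm (coef \<Lambda> B n r) \<le> C * \<rho> ^ n * exp (\<nu> * r)"
proof -
  let ?\<BB> = "shifted \<Lambda> \<nu> \<BB>"
  obtain D where D: "0 < D" "\<And>X. norm X \<le> D * nrm X" using norm_le_is_matrix_norm[OF nrm] by blast
  \<comment> \<open>The maximum with 0 forces the intermediate rate \<open>\<rho>\<close> to be
    positive.\<close>
  have "max 0 (mu_HS nrm \<Lambda> ?\<BB>) < 1" using mu by simp
  then obtain \<rho> where \<rho>: "max 0 (mu_HS nrm \<Lambda> ?\<BB>) < ereal \<rho>" "ereal \<rho> < 1" using ereal_dense2 by blast
  then have \<rho>01: "0 < \<rho>" "\<rho> < 1" by (auto simp: zero_ereal_def one_ereal_def)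
  have "mu_HS nrm \<Lambda> ?\<BB> < ereal \<rho>" using \<rho> by simp
  then have "eventually (\<lambda>n. (SUP \<theta>\<in>Vtilde \<Lambda>. SUP B\<in>Lcal_below \<Lambda> (real n * vmax \<Lambda>) \<rightarrow>\<^sub>E ?\<BB>.
       ereal (root n (nrm (HS_sum \<Lambda> \<theta> B n)))) < ereal \<rho>) sequentially"
    unfolding mu_HS_def by (rule Limsup_lessD)
  then obtain n0 where n0: "\<forall>n\<ge>n0. (SUP \<theta>\<in>Vtilde \<Lambda>. SUP B\<in>Lcal_below \<Lambda> (real n * vmax \<Lambda>) \<rightarrow>\<^sub>E ?\<BB>.
       ereal (root n (nrm (HS_sum \<Lambda> \<theta> B n)))) < ereal \<rho>"
    unfolding eventually_sequentially by (elim exE)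
  have large: "norm (coef \<Lambda> B n r) \<le> D * \<rho> ^ n"
    if B: "\<forall>s. B s \<in> ?\<BB>" and n: "n0 \<le> n" "1 \<le> n" for B n r
  proof (cases "r \<in> shell \<Lambda> n")
    case True
    show ?thesis
    proof (rule norm_le_of_trig_sum_bound[OF finite_shell True])
      fix s :: real
      \<comment> \<open>The supremum in \<open>mu_HS\<close> ranges over extensional families, so
        \<open>B\<close> is cut down to their index set; this does not change the sum.\<close>
      define B' where "B' = restrict B (Lcal_below \<Lambda> (real n * vmax \<Lambda>))"
      have "HS_sum \<Lambda> (s *\<^sub>R \<Lambda>) B n = (\<Sum>r\<in>shell \<Lambda> n. mscale (cis (s * r)) (coef \<Lambda> B n r))"
        by (rule HS_sum_eq_sum_coef) (simp_all add: cis_mult algebra_simps)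
      moreover have "HS_sum \<Lambda> (s *\<^sub>R \<Lambda>) B n = HS_sum \<Lambda> (s *\<^sub>R \<Lambda>) B' n"
        using shell_subset_Lcal_below[OF pos] by (intro HS_sum_cong) (auto simp: B'_def)
      moreover have "ereal (root n (nrm (HS_sum \<Lambda> (s *\<^sub>R \<Lambda>) B' n))) < ereal \<rho>"
      proof (rule le_less_trans[OF _ n0[rule_format, OF n(1)]])
        show "ereal (root n (nrm (HS_sum \<Lambda> (s *\<^sub>R \<Lambda>) B' n))) \<le>
           (SUP \<theta>\<in>Vtilde \<Lambda>. SUP B\<in>Lcal_below \<Lambda> (real n * vmax \<Lambda>) \<rightarrow>\<^sub>E ?\<BB>. ereal (root n (nrm (HS_sum \<Lambda> \<theta> B n))))"
          by (rule SUP_upper2[OF scaled_mem_Vtilde], rule SUP_upper) (auto simp: B'_def B)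
      qed
      then have "nrm (HS_sum \<Lambda> (s *\<^sub>R \<Lambda>) B' n) \<le> \<rho> ^ n"
        using n(2) nrm \<rho>01 real_root_less_iff[of n _ "\<rho> ^ n"]
        by (simp add: real_root_power_cancel is_matrix_norm_def)
      ultimately show "norm (\<Sum>r\<in>shell \<Lambda> n. mscale (cis (s * r)) (coef \<Lambda> B n r)) \<le> D * \<rho> ^ n"
        using D(2)[of "HS_sum \<Lambda> (s *\<^sub>R \<Lambda>) B' n"] D(1) by (auto intro: order_trans)
    qed
  qed (use D \<rho>01 in \<open>simp add: coef_eq_0\<close>)
  obtain c where c: "\<And>n B r. \<forall>s. B s \<in> ?\<BB> \<Longrightarrow> norm (coef \<Lambda> B n r) \<le> c n"
    using bounded_coef[OF bounded_shifted[OF assms(3)]] by metis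
  \<comment> \<open>Enlarges \<open>D\<close> to cover the lengths up to \<open>n0\<close>
    inclusive. The remaining lengths are positive, as the n-th root in \<open>large\<close>
    requires.\<close>
  define C where "C = D + (\<Sum>n\<le>n0. \<bar>c n\<bar> / \<rho> ^ n)"
  have CD: "D \<le> C" unfolding C_def using \<rho>01 by (auto intro!: sum_nonneg)
  have bound: "norm (coef \<Lambda> B n r) \<le> C * \<rho> ^ n" if B: "\<forall>s. B s \<in> ?\<BB>" for B n r
  proof (cases "n \<le> n0")
    case True
    have "\<bar>c n\<bar> / \<rho> ^ n \<le> (\<Sum>n\<le>n0. \<bar>c n\<bar> / \<rho> ^ n)"
      using \<rho>01 True by (intro member_le_sum) auto
    then have "\<bar>c n\<bar> / \<rho> ^ n \<le> C" unfolding C_def using D(1) by simp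
    then have "\<bar>c n\<bar> \<le> C * \<rho> ^ n" using \<rho>01 by (simp add: pos_divide_le_eq)
    then show ?thesis using c[OF B, of n r] by simp
  next
    case False
    then show ?thesis using large[OF B, of n r] CD \<rho>01 by (auto elim!: order_trans intro!: mult_right_mono)
  qed
  show thesis
  proof (rule that[OF _ \<rho>01])
    show "0 < C" using CD D(1) by simp
    fix B :: "real \<Rightarrow> complex^'d^'d^'n" and n r assume B: "\<forall>s. B s \<in> \<BB>"
    have "norm (exp (- \<nu> * r) *\<^sub>R coef \<Lambda> B n r) \<le> C * \<rho> ^ n"
      unfolding coef_scale[symmetric] by (rule bound) (auto simp: shifted_def B)
    then show "norm (coef \<Lambda> B n r) \<le> C * \<rho> ^ n * exp (\<nu> * r)"
      by (simp add: exp_minus field_simps)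
  qed
qed

lemma eventually_poly_le_geometric:
  fixes K x y :: real
  assumes "0 < x" "x < y"
  shows "eventually (\<lambda>n. K * real (Suc n) ^ M * x ^ n \<le> y ^ n) sequentially"
proof -
  define a where "a = ln y - ln x"
  have a: "0 < a" using assms by (simp add: a_def)
  then have "((\<lambda>n. K * real (Suc n) ^ M * exp (- a * real n)) \<longlongrightarrow> 0) sequentially"
    by real_asymp
  then have "eventually (\<lambda>n. K * real (Suc n) ^ M * exp (- a * real n) < 1) sequentially"
    by (rule order_tendstoD) simp
  then show ?thesis
  proof eventually_elim
    case (elim n)
    have "x ^ n = exp (- a * real n) * y ^ n"
    proof -
      have "exp (- a) * y = x" using assms by (simp add: a_def exp_diff)
      then have "x ^ n = exp (- a) ^ n * y ^ n" by (simp add: power_mult_distrib[symmetric])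
      then show ?thesis by (simp add: exp_of_nat_mult[symmetric] mult.commute)
    qed
    then have "K * real (Suc n) ^ M * x ^ n = (K * real (Suc n) ^ M * exp (- a * real n)) * y ^ n" by simp
    also have "\<dots> \<le> 1 * y ^ n" using elim assms by (intro mult_right_mono) auto
    finally show ?case by simp
  qed
qed

text \<open>Converse of the averaging step: after regrouping, the triangle inequality costs only the
  polynomial size of the shell. Membership in \<open>\<BB>\<close> is asked only on the shells that
  are read, since the families in \<open>mu_HS\<close> are controlled nowhere else.\<close>

lemma mu_HS_less_1:
  fixes \<Lambda> :: "real^'n" and \<BB> :: "(complex^'d^'d^'n) set"
  assumes nrm: "is_matrix_norm nrm" and pos: "\<And>j. 0 < \<Lambda> $ j" and \<rho>: "0 < \<rho>" "\<rho> < 1" and "0 \<le> C" and "1 \<le> m"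
    and coef: "\<And>B n r. (\<And>k s. k < n \<Longrightarrow> s \<in> shell \<Lambda> k \<Longrightarrow> B s \<in> \<BB>) \<Longrightarrow> m \<le> n \<Longrightarrow> r \<in> shell \<Lambda> n \<Longrightarrow>
      norm (coef \<Lambda> B n r) \<le> C * \<rho> ^ n"
  shows "mu_HS nrm \<Lambda> \<BB> < 1"
proof -
  obtain D where D: "0 < D" "\<And>X. nrm X \<le> D * norm X" using is_matrix_norm_le_norm[OF nrm] by blast
  \<comment> \<open>The gap between \<open>\<rho>\<close> and \<open>y\<close> absorbs the
    polynomial factor and the norm constant.\<close>
  obtain y where y: "\<rho> < y" "y < 1" using \<rho> dense by blast
  have HS: "norm (HS_sum \<Lambda> \<theta> B n) \<le> real (Suc n) ^ CARD('n) * (C * \<rho> ^ n)"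
    if \<theta>: "\<theta> \<in> Vtilde \<Lambda>" and B: "B \<in> Lcal_below \<Lambda> (real n * vmax \<Lambda>) \<rightarrow>\<^sub>E \<BB>" and n: "m \<le> n" for \<theta> B n
  proof -
    obtain L where L: "L \<in> Vset \<Lambda>" "\<And>j. [\<theta> $ j = L $ j] (rmod (2 * pi))"
      using \<theta> by (auto simp: Vtilde_def)
    \<comment> \<open>Only the class of \<open>\<theta>\<close> modulo \<open>2 * pi\<close>
      matters, so the phases come from a vector of \<open>Vset \<Lambda>\<close> and are functions
      of the total delay.\<close>
    then have cis: "cis (\<theta> $ j) = cis (L $ j)" for j by (simp add: cis_eq_iff)
    have "HS_sum \<Lambda> \<theta> B n = (\<Sum>r\<in>shell \<Lambda> n. mscale (cis (transfer \<Lambda> L r)) (coef \<Lambda> B n r))"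
      by (rule HS_sum_eq_sum_coef) (simp_all add: transfer_0 transfer_add L cis cis_mult)
    also have "norm \<dots> \<le> (\<Sum>r\<in>shell \<Lambda> n. C * \<rho> ^ n)"
    proof (intro order_trans[OF norm_sum] sum_mono)
      fix r assume "r \<in> shell \<Lambda> n"
      then have "norm (coef \<Lambda> B n r) \<le> C * \<rho> ^ n"
        using B shell_subset_Lcal_below[OF pos] n by (intro coef) (auto simp: PiE_def Pi_def subset_iff)
      then show "norm (mscale (cis (transfer \<Lambda> L r)) (coef \<Lambda> B n r)) \<le> C * \<rho> ^ n"
        by (simp add: norm_mscale)
    qed
    also have "\<dots> = real (card (shell \<Lambda> n)) * (C * \<rho> ^ n)" by simp
    also have "\<dots> \<le> real (Suc n) ^ CARD('n) * (C * \<rho> ^ n)"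
      using card_shell_le[of \<Lambda> n] \<rho> \<open>0 \<le> C\<close>
      by (intro mult_right_mono) (simp only: of_nat_power[symmetric] of_nat_le_iff, simp)
    finally show ?thesis .
  qed
  have "eventually (\<lambda>n. (SUP \<theta>\<in>Vtilde \<Lambda>. SUP B\<in>Lcal_below \<Lambda> (real n * vmax \<Lambda>) \<rightarrow>\<^sub>E \<BB>.
       ereal (root n (nrm (HS_sum \<Lambda> \<theta> B n)))) \<le> ereal y) sequentially"
    using eventually_poly_le_geometric[OF \<rho>(1) y(1), of "D * C" "CARD('n)"] eventually_ge_at_top[of m]
  proof eventually_elim
    case (elim n)
    have n: "0 < n" using elim(2) \<open>1 \<le> m\<close> by simp
    show ?case
    proof (intro SUP_least)
      fix \<theta> B assume *: "\<theta> \<in> Vtilde \<Lambda>" "B \<in> Lcal_below \<Lambda> (real n * vmax \<Lambda>) \<rightarrow>\<^sub>E \<BB>"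
      have "nrm (HS_sum \<Lambda> \<theta> B n) \<le> D * norm (HS_sum \<Lambda> \<theta> B n)" by (rule D)
      also have "\<dots> \<le> D * (real (Suc n) ^ CARD('n) * (C * \<rho> ^ n))"
        using D(1) HS[OF * elim(2)] by (intro mult_left_mono) auto
      also have "\<dots> \<le> y ^ n" using elim(1) by (simp only: ac_simps)
      finally have "root n (nrm (HS_sum \<Lambda> \<theta> B n)) \<le> root n (y ^ n)" using n by simp
      then show "ereal (root n (nrm (HS_sum \<Lambda> \<theta> B n))) \<le> ereal y"
        using n \<rho> y by (simp add: real_root_power_cancel)
    qed
  qed
  then have "mu_HS nrm \<Lambda> \<BB> \<le> ereal y" unfolding mu_HS_def by (rule Limsup_bounded)
  also have "\<dots> < 1" using y(2) by simp
  finally show ?thesis .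
qed

section \<open>Solutions\<close>

text \<open>
  The equation is substituted into itself until the time argument becomes negative. Words of equal
  total delay visit the same times, because \<open>L \<in> V(\<Lambda>)\<close>.
\<close>

lemma solution_formula:
  fixes \<Lambda> L :: "real^'n" and A :: "real \<Rightarrow> complex^'d^'d^'n"
  assumes L: "L \<in> Vset \<Lambda>" and pos: "\<And>j. 0 < L $ j" and sol: "is_solution L A u0 u"
    and t: "0 \<le> t" "t < real N * vmin L"
  defines "l \<equiv> transfer \<Lambda> L"
  shows "u t = (\<Sum>k<N. \<Sum>r\<in>shell \<Lambda> k. \<Sum>j\<in>UNIV. if l r \<le> t \<and> t < l r + L $ j
    then coef \<Lambda> (\<lambda>r. A (t - l r)) k r *v (A (t - l r) $ j *v u0 (t - l r - L $ j)) else 0)"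
proof -
  interpret M: bounded_bilinear "(*v) :: complex^'d^'d \<Rightarrow> complex^'d \<Rightarrow> complex^'d"
    by (rule bounded_bilinear_matrix_vector_mult)
  define c where "c = coef \<Lambda> (\<lambda>r. A (t - l r))"
  define S where "S k = (\<Sum>r\<in>shell \<Lambda> k. \<Sum>j\<in>UNIV. if l r \<le> t \<and> t < l r + L $ j
    then c k r *v (A (t - l r) $ j *v u0 (t - l r - L $ j)) else 0)" for k
  \<comment> \<open>The words still pending: their time argument is nonnegative, so the equation can
    be applied again.\<close>
  define F where "F r X = (if l r \<le> t then X *v u (t - l r) else 0)" for r and X :: "complex^'d^'d"
  have l_add: "l (r + \<Lambda> $ j) = l r + L $ j" if "r \<in> shell \<Lambda> k" for r j k
    unfolding l_def by (rule transfer_add[OF L that])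
  \<comment> \<open>One substitution: each extended word either stays pending, in the next shell, or
    has just reached a negative time and reads \<open>u0\<close>, in \<open>S n\<close>.\<close>
  have step: "(\<Sum>r\<in>shell \<Lambda> n. F r (c n r)) = (\<Sum>r\<in>shell \<Lambda> (Suc n). F r (c (Suc n) r)) + S n" for n
  proof -
    have "F r (c n r) = (\<Sum>j\<in>UNIV. F (r + \<Lambda> $ j) (c n r ** A (t - l r) $ j)) +
      (\<Sum>j\<in>UNIV. if l r \<le> t \<and> t < l r + L $ j
        then c n r *v (A (t - l r) $ j *v u0 (t - l r - L $ j)) else 0)" if r: "r \<in> shell \<Lambda> n" for r
    proof (cases "l r \<le> t")
      case True
      have "u (t - l r) = (\<Sum>j\<in>UNIV. A (t - l r) $ j *v u (t - l r - L $ j))"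
        using sol True by (simp add: is_solution_def)
      then have "F r (c n r) = (\<Sum>j\<in>UNIV. c n r *v (A (t - l r) $ j *v u (t - l r - L $ j)))"
        using True by (simp add: F_def M.sum_right)
      also have "\<dots> = (\<Sum>j\<in>UNIV. F (r + \<Lambda> $ j) (c n r ** A (t - l r) $ j) + (if l r \<le> t \<and> t < l r + L $ j
        then c n r *v (A (t - l r) $ j *v u0 (t - l r - L $ j)) else 0))"
      proof (rule sum.cong[OF refl])
        fix j
        have "u (t - l r - L $ j) = u0 (t - l r - L $ j)" if "t < l r + L $ j"
          using sol that True le_vmax[of L j] by (simp add: is_solution_def)
        then show "c n r *v (A (t - l r) $ j *v u (t - l r - L $ j)) = F (r + \<Lambda> $ j) (c n r ** A (t - l r) $ j) +
          (if l r \<le> t \<and> t < l r + L $ j then c n r *v (A (t - l r) $ j *v u0 (t - l r - L $ j)) else 0)"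
          using True by (auto simp: F_def l_add[OF r] matrix_vector_mul_assoc diff_diff_eq)
      qed
      finally show ?thesis by (simp add: sum.distrib)
    next
      case False
      moreover have "\<not> l r + L $ j \<le> t" for j using False pos[of j] by simp
      ultimately show ?thesis by (simp add: F_def l_add[OF r])
    qed
    then have "(\<Sum>r\<in>shell \<Lambda> n. F r (c n r)) =
      (\<Sum>r\<in>shell \<Lambda> n. \<Sum>j\<in>UNIV. F (r + \<Lambda> $ j) (c n r ** A (t - l r) $ j)) + S n"
      by (simp add: sum.distrib S_def)
    also have "(\<Sum>r\<in>shell \<Lambda> n. \<Sum>j\<in>UNIV. F (r + \<Lambda> $ j) (c n r ** A (t - l r) $ j)) =
      (\<Sum>r\<in>shell \<Lambda> (Suc n). F r (c (Suc n) r))"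
      unfolding c_def by (rule sum_shell_coef_Suc[symmetric]) (simp add: Modules.additive_def F_def M.add_left)
    finally show ?thesis .
  qed
  have main: "u t = (\<Sum>r\<in>shell \<Lambda> n. F r (c n r)) + (\<Sum>k<n. S k)" for n
  proof (induction n)
    case 0
    show ?case using t by (simp add: F_def c_def l_def transfer_0[OF L])
  next
    case (Suc n)
    then show ?case unfolding step[of n] by (simp only: sum.lessThan_Suc ac_simps)
  qed
  \<comment> \<open>After \<open>N\<close> letters the delay is at least \<open>N * vmin L\<close>,
    which exceeds \<open>t\<close>, so nothing is pending.\<close>
  have "F r (c N r) = 0" if "r \<in> shell \<Lambda> N" for r
    using shell_ge[OF transfer_mem_shell[OF L that]] t by (simp add: F_def l_def)
  then have "u t = (\<Sum>k<N. S k)" using main[of N] by simp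
  then show ?thesis by (simp only: S_def c_def)
qed

section \<open>Translations of Lebesgue measure and measurability of solutions\<close>

lemma measurable_shift_lebesgue: "(\<lambda>x::real. x - s) \<in> lebesgue \<rightarrow>\<^sub>M lebesgue"
  using lebesgue_affine_measurable[where c = "\<lambda>x::real. 1" and t = "- s"] by simp

lemma distr_shift_lebesgue: "distr lebesgue lebesgue (\<lambda>x::real. x - s) = lebesgue"
proof -
  have "density M (\<lambda>_. 1) = M" for M :: "real measure" by (rule density_1)
  then show ?thesis using lebesgue_real_affine[of 1 "- s"] by simp
qed

lemma nn_integral_shift_lebesgue:
  assumes "f \<in> borel_measurable lebesgue"
  shows "(\<integral>\<^sup>+x. f (x - s) \<partial>lebesgue) = (\<integral>\<^sup>+(x::real). f x \<partial>lebesgue)"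
  using nn_integral_real_affine_lebesgue[OF assms, of 1 "- s"] by simp

lemma AE_shift_lebesgue:
  fixes P :: "real \<Rightarrow> bool"
  assumes "AE x in lebesgue. P x"
  shows "AE x in lebesgue. P (x - s)"
  by (rule AE_distrD[OF measurable_shift_lebesgue]) (subst distr_shift_lebesgue, rule assms)

text \<open>\<open>is_solution\<close> is purely pointwise, so measurability has to be derived. The
  method of steps extends it by one interval of length \<open>vmin L\<close> at a time.\<close>

lemma solution_measurable:
  fixes L :: "real^'n" and A :: "real \<Rightarrow> complex^'d^'d^'n"
  assumes pos: "\<And>j. 0 < L $ j" and sol: "is_solution L A u0 u"
    and A: "A \<in> borel_measurable lebesgue"
    and u0: "u0 \<in> borel_measurable (lebesgue_on {- vmax L..<0})" and T: "0 \<le> T"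
  shows "history u T \<in> borel_measurable (lebesgue_on {- vmax L..<0})"
proof -
  let ?W = "{- vmax L..<0}"
  have u0': "(\<lambda>x. indicator ?W x *\<^sub>R u0 x) \<in> borel_measurable lebesgue"
    using u0 by (subst (asm) borel_measurable_restrict_space_iff) auto
  \<comment> \<open>The solution cut off after \<open>n\<close> steps; below the next cut-off all
    delayed arguments fall in the part already treated.\<close>
  define U where "U n t = indicator {- vmax L..<real n * vmin L} t *\<^sub>R u t" for n t
  have cont: "continuous_on UNIV (\<lambda>(X :: complex^'d^'d, x). X *v x)"
    unfolding case_prod_unfold
    by (intro bounded_bilinear.continuous_on[OF bounded_bilinear_matrix_vector_mult] continuous_intros)
  have U: "U n \<in> borel_measurable lebesgue" for n
  proof (induction n)
    case 0
    have "U 0 = (\<lambda>x. indicator ?W x *\<^sub>R u0 x)"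
      using sol by (auto simp: U_def[abs_def] is_solution_def indicator_def fun_eq_iff)
    then show ?case using u0' by simp
  next
    case (Suc n)
    have Aj: "(\<lambda>t. A t $ j) \<in> borel_measurable lebesgue" for j
      by (rule measurable_compose[OF A]) (intro borel_measurable_continuous_onI continuous_intros)
    have "(\<lambda>t. A t $ j *v U n (t - L $ j)) \<in> borel_measurable lebesgue" for j
      by (rule borel_measurable_continuous_Pair[OF Aj measurable_compose[OF measurable_shift_lebesgue Suc.IH]])
        (use cont in \<open>simp add: case_prod_unfold\<close>)
    then have m: "(\<lambda>t. indicator ?W t *\<^sub>R u0 t + indicator {0..<real (Suc n) * vmin L} t *\<^sub>R
        (\<Sum>j\<in>UNIV. A t $ j *v U n (t - L $ j))) \<in> borel_measurable lebesgue"
      by (intro borel_measurable_add u0' borel_measurable_scaleR borel_measurable_indicator borel_measurable_sum) auto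
    have "U (Suc n) t = indicator ?W t *\<^sub>R u0 t + indicator {0..<real (Suc n) * vmin L} t *\<^sub>R
        (\<Sum>j\<in>UNIV. A t $ j *v U n (t - L $ j))" for t
    proof (cases "0 \<le> t \<and> t < real (Suc n) * vmin L")
      case True
      have "U n (t - L $ j) = u (t - L $ j)" for j
        using True vmin_le[of L j] le_vmax[of L j] by (auto simp: U_def indicator_def algebra_simps)
      moreover have "u t = (\<Sum>j\<in>UNIV. A t $ j *v u (t - L $ j))"
        using True sol by (simp add: is_solution_def)
      ultimately show ?thesis using True vmax_pos[OF pos]
        by (simp add: U_def[of "Suc n"] indicator_def)
    next
      case False
      have "0 \<le> real (Suc n) * vmin L" using vmin_pos[OF pos] by simp
      then show ?thesis using False sol by (auto simp: U_def is_solution_def indicator_def)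
    qed
    then show ?case using m by (subst measurable_cong) auto
  qed
  obtain n where n: "T < real n * vmin L" using reals_Archimedean3[OF vmin_pos[OF pos]] by blast
  have "(\<lambda>x. indicator ?W x *\<^sub>R U n (x - (- T))) \<in> borel_measurable lebesgue"
    by (intro borel_measurable_scaleR borel_measurable_indicator measurable_compose[OF measurable_shift_lebesgue U]) auto
  moreover have "(\<lambda>x. indicator ?W x *\<^sub>R U n (x - (- T))) = (\<lambda>x. indicator ?W x *\<^sub>R history u T x)"
    using n T by (auto simp: U_def history_def indicator_def)
  ultimately show ?thesis
    by (subst borel_measurable_restrict_space_iff) simp_all
qed

section \<open>Norms of functions dominated by translates of the datum\<close>

lemma sum_powr_le:
  fixes a :: "'i \<Rightarrow> real"
  assumes "finite I" "\<And>i. i \<in> I \<Longrightarrow> 0 \<le> a i" "1 \<le> q"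
  shows "(\<Sum>i\<in>I. a i) powr q \<le> real (card I) powr q * (\<Sum>i\<in>I. a i powr q)"
proof (cases "I = {}")
  case False
  \<comment> \<open>The sum is at most \<open>card I\<close> times its largest term, whose power is
    one of the summands on the right.\<close>
  define m where "m = Max (a ` I)"
  have m: "m \<in> a ` I" unfolding m_def using assms False by (intro Max_in) auto
  then obtain i where i: "i \<in> I" "m = a i" by blast
  have "(\<Sum>i\<in>I. a i) \<le> (\<Sum>i\<in>I. m)" unfolding m_def using assms by (intro sum_mono) auto
  then have "(\<Sum>i\<in>I. a i) powr q \<le> (real (card I) * m) powr q"
    using assms by (intro powr_mono2) (auto intro: sum_nonneg)
  also have "\<dots> = real (card I) powr q * a i powr q" using i assms by (simp add: powr_mult)
  also have "\<dots> \<le> real (card I) powr q * (\<Sum>i\<in>I. a i powr q)"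
    using i assms by (intro mult_left_mono member_le_sum) auto
  finally show ?thesis .
qed simp

lemma enn2real_ge_1: "1 \<le> p \<Longrightarrow> p \<noteq> \<infinity> \<Longrightarrow> 1 \<le> enn2real p"
  by (cases p) (auto simp: enn2real_ennreal top_unique ennreal_1[symmetric] simp del: ennreal_1)

text \<open>All translates of the datum, extended by zero, have the same norm. For finite
  \<open>p\<close> one factor \<open>card I\<close> comes from \<open>sum_powr_le\<close>, and the
  other bounds \<open>card I\<close> to the power \<open>1/p\<close>; the square thus serves all
  \<open>p\<close> at once.\<close>

lemma Xnorm_le_of_shift_bound:
  fixes L :: "real^'n" and u0 f :: "real \<Rightarrow> complex^'d"
  assumes p: "1 \<le> p" and u0: "u0 \<in> Xspace p L" and I: "finite I" "I \<noteq> {}" and D: "0 \<le> D"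
    and f: "f \<in> borel_measurable (lebesgue_on {- vmax L..<0})"
    and bound: "\<And>x. x \<in> {- vmax L..<0} \<Longrightarrow>
      norm (f x) \<le> D * (\<Sum>i\<in>I. indicator {- vmax L..<0} (x - s i) * norm (u0 (x - s i)))"
  shows "Xnorm p L f \<le> ennreal (D * real (card I) ^ 2) * Xnorm p L u0"
proof -
  let ?W = "{- vmax L..<0}"
  define g where "g x = indicator ?W x * norm (u0 x)" for x
  define c where "c = real (card I)"
  have c1: "1 \<le> c" using I by (simp add: c_def Suc_le_eq card_gt_0_iff)
  have g0: "0 \<le> g x" for x by (simp add: g_def)
  have "(\<lambda>x. indicator ?W x *\<^sub>R u0 x) \<in> borel_measurable lebesgue"
    using u0 by (subst (asm) Xspace_def) (simp add: borel_measurable_restrict_space_iff)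
  then have "(\<lambda>x. norm (indicator ?W x *\<^sub>R u0 x)) \<in> borel_measurable lebesgue" by (rule measurable_compose) simp
  then have g: "g \<in> borel_measurable lebesgue" by (simp add: g_def[abs_def])
  have fin: "Xnorm p L u0 < \<infinity>" using u0 by (simp add: Xspace_def)
  show ?thesis
  proof (cases "p = \<infinity>")
    case True
    define E where "E = esssup (lebesgue_on ?W) (\<lambda>x. ennreal (norm (u0 x)))"
    have XE: "Xnorm p L u0 = E" by (simp add: Xnorm_def Lp_norm_def True E_def)
    then obtain e where e: "E = ennreal e" "0 \<le> e" using fin by (cases E) auto
    have "AE x in lebesgue_on ?W. ennreal (norm (u0 x)) \<le> E" unfolding E_def by (rule esssup_AE)
    then have "AE x in lebesgue. x \<in> ?W \<longrightarrow> norm (u0 x) \<le> e"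
      by (subst (asm) AE_restrict_space_iff) (auto simp: e)
    then have "AE x in lebesgue. g x \<le> e" by eventually_elim (auto simp: g_def indicator_def e)
    then have "AE x in lebesgue. \<forall>i\<in>I. g (x - s i) \<le> e"
      using I by (intro AE_finite_allI AE_shift_lebesgue)
    then have "AE x in lebesgue. x \<in> ?W \<longrightarrow> ennreal (norm (f x)) \<le> ennreal (D * (c * e))"
    proof eventually_elim
      case (elim x)
      have "(\<Sum>i\<in>I. g (x - s i)) \<le> c * e" using elim sum_bounded_above[of I "\<lambda>i. g (x - s i)" e] by (simp add: c_def)
      then show ?case using bound[of x] D
        by (auto simp: g_def[symmetric] intro!: ennreal_leI order_trans[OF bound] mult_left_mono)
    qed
    then have "AE x in lebesgue_on ?W. ennreal (norm (f x)) \<le> ennreal (D * (c * e))"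
      by (subst AE_restrict_space_iff) auto
    then have "Xnorm p L f \<le> ennreal (D * (c * e))"
      unfolding Xnorm_def Lp_norm_def using True f by (auto intro!: esssup_I)
    also have "\<dots> \<le> ennreal (D * c ^ 2 * e)"
    proof (rule ennreal_leI)
      have "D * e * (c * 1) \<le> D * e * (c * c)" using c1 D e by (intro mult_left_mono) auto
      then show "D * (c * e) \<le> D * c\<^sup>2 * e" by (simp add: power2_eq_square ac_simps)
    qed
    also have "\<dots> = ennreal (D * c ^ 2) * Xnorm p L u0" using D e by (simp add: XE ennreal_mult'')
    finally show ?thesis by (simp add: c_def)
  next
    case False
    define q where "q = enn2real p"
    have q: "1 \<le> q" unfolding q_def by (rule enn2real_ge_1[OF p False])
    define J where "J = (\<integral>\<^sup>+x. ennreal (norm (u0 x) powr q) \<partial>lebesgue_on ?W)"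
    define J' where "J' = (\<integral>\<^sup>+x. ennreal (norm (f x) powr q) \<partial>lebesgue_on ?W)"
    have XJ: "Xnorm p L u0 = (if J = \<infinity> then \<infinity> else ennreal (enn2real J powr (1 / q)))"
      "Xnorm p L f = (if J' = \<infinity> then \<infinity> else ennreal (enn2real J' powr (1 / q)))"
      using False by (simp_all add: Xnorm_def Lp_norm_def J_def J'_def q_def Let_def)
    then obtain e where e: "J = ennreal e" "0 \<le> e" using fin by (cases J) auto
    have gq: "(\<lambda>x. ennreal (g x powr q)) \<in> borel_measurable lebesgue" using g by measurable
    have Jg: "(\<integral>\<^sup>+x. ennreal (g x powr q) \<partial>lebesgue) = J"
      unfolding J_def by (subst nn_integral_restrict_space)
        (auto intro!: nn_integral_cong simp: g_def indicator_def)
    have "J' = (\<integral>\<^sup>+x. ennreal (norm (f x) powr q) * indicator ?W x \<partial>lebesgue)"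
      unfolding J'_def by (subst nn_integral_restrict_space) auto
    also have "\<dots> \<le> (\<integral>\<^sup>+x. (\<Sum>i\<in>I. ennreal (D powr q * c powr q) * ennreal (g (x - s i) powr q)) \<partial>lebesgue)"
    proof (rule nn_integral_mono)
      fix x :: real
      have "norm (f x) powr q \<le> D powr q * c powr q * (\<Sum>i\<in>I. g (x - s i) powr q)" if "x \<in> ?W"
      proof -
        have "norm (f x) powr q \<le> (D * (\<Sum>i\<in>I. g (x - s i))) powr q"
          using bound[OF that] q by (intro powr_mono2) (auto simp: g_def)
        also have "\<dots> = D powr q * (\<Sum>i\<in>I. g (x - s i)) powr q"
          using D g0 by (intro powr_mult)
        also have "\<dots> \<le> D powr q * (c powr q * (\<Sum>i\<in>I. g (x - s i) powr q))"
          unfolding c_def using I g0 q by (intro mult_left_mono sum_powr_le) auto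
        finally show ?thesis by (simp only: ac_simps)
      qed
      moreover have "(\<Sum>i\<in>I. ennreal (D powr q * c powr q) * ennreal (g (x - s i) powr q)) =
          ennreal (D powr q * c powr q * (\<Sum>i\<in>I. g (x - s i) powr q))"
        by (simp add: sum_distrib_left[symmetric] ennreal_mult sum_ennreal sum_nonneg)
      ultimately show "ennreal (norm (f x) powr q) * indicator ?W x \<le>
          (\<Sum>i\<in>I. ennreal (D powr q * c powr q) * ennreal (g (x - s i) powr q))"
        by (auto simp: indicator_def intro!: ennreal_leI)
    qed
    also have "\<dots> = (\<Sum>i\<in>I. ennreal (D powr q * c powr q) * J)"
    proof -
      have m: "(\<lambda>x. ennreal (g (x - s i) powr q)) \<in> borel_measurable lebesgue" for i
        by (rule measurable_compose[OF measurable_shift_lebesgue gq])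
      then show ?thesis
        by (simp add: nn_integral_sum nn_integral_cmult nn_integral_shift_lebesgue[OF gq] Jg)
    qed
    also have "\<dots> = ennreal (D powr q * c powr q * c * e)"
      using c1 by (simp add: e c_def ennreal_mult ennreal_of_nat_eq_real_of_nat ac_simps)
    finally have J': "J' \<le> ennreal (D powr q * c powr q * c * e)" .
    then have "J' \<noteq> \<infinity>" by (auto simp: top_unique)
    have "enn2real J' \<le> D powr q * c powr q * c * e"
      using J' c1 e by (intro enn2real_leI) auto
    then have "enn2real J' powr (1 / q) \<le> (D powr q * c powr q * c * e) powr (1 / q)"
      using q by (intro powr_mono2) auto
    also have "\<dots> = D * c * c powr (1 / q) * e powr (1 / q)"
      using q D c1 e by (simp add: powr_mult powr_powr)
    also have "\<dots> \<le> D * c * c * e powr (1 / q)"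
      using q D c1 powr_mono[of "1 / q" 1 c] by (intro mult_left_mono mult_right_mono) auto
    finally have "Xnorm p L f \<le> ennreal (D * c ^ 2 * e powr (1 / q))"
      using \<open>J' \<noteq> \<infinity>\<close> by (simp add: XJ power2_eq_square ac_simps ennreal_leI)
    also have "\<dots> = ennreal (D * c ^ 2) * Xnorm p L u0"
      using e D by (simp add: XJ ennreal_mult'')
    finally show ?thesis by (simp add: c_def)
  qed
qed

section \<open>Exponential type and Lyapunov exponent from coefficient bounds\<close>

lemma power_le_fact_mult_exp:
  fixes x :: real
  assumes "0 \<le> x"
  shows "x ^ k \<le> fact k * exp x"
proof -
  have "(\<Sum>n\<in>{k}. x ^ n /\<^sub>R fact n) \<le> (\<Sum>n. x ^ n /\<^sub>R fact n)"
    using assms by (intro sum_le_suminf summable_exp_generic) auto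
  then show ?thesis by (simp add: exp_def field_simps)
qed

text \<open>Words that contribute near time \<open>T\<close> have delay within
  \<open>2 * vmax L\<close> of \<open>T\<close>, hence length at least
  \<open>T / vmax L - 2\<close>; so \<open>\<rho> ^ n\<close> becomes the rate
  \<open>ln \<rho> / vmax L\<close>. The bound in terms of \<open>transfer\<close> covers both
  \<open>\<nu> = 0\<close> with arbitrary \<open>L\<close> and \<open>L = \<Lambda>\<close> with
  arbitrary \<open>\<nu>\<close>.\<close>

lemma exp_type_of_coef_bound:
  fixes \<Lambda> L :: "real^'n" and \<BB> :: "(complex^'d^'d^'n) set"
  assumes L: "L \<in> Vset \<Lambda>" and pos: "\<And>j. 0 < L $ j" and bdd: "bounded \<BB>" and p: "1 \<le> p"
    and C: "0 < C" and \<rho>: "0 < \<rho>" "\<rho> < 1"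
    and coef: "\<And>B n r. \<forall>s. B s \<in> \<BB> \<Longrightarrow> r \<in> shell \<Lambda> n \<Longrightarrow>
      norm (coef \<Lambda> B n r) \<le> C * \<rho> ^ n * exp (\<nu> * transfer \<Lambda> L r)"
  shows "exp_type p L (Linf_valued \<BB>) (\<nu> + ln \<rho> / vmax L)"
  unfolding exp_type_def
proof (intro allI impI)
  fix \<epsilon> :: real assume \<epsilon>: "0 < \<epsilon>"
  define V w a M where "V = vmax L" and "w = vmin L" and "a = - ln \<rho>" and "M = CARD('n)"
  define \<gamma> where "\<gamma> = \<nu> + ln \<rho> / vmax L"
  define l where "l = transfer \<Lambda> L"
  have V: "0 < V" and w: "0 < w" and a: "0 < a"
    using vmax_pos[OF pos] vmin_pos[OF pos] \<rho> by (auto simp: V_def w_def a_def)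
  have \<gamma>: "\<gamma> = \<nu> - a / V" by (simp add: \<gamma>_def a_def V_def)
  obtain K1 where K1: "0 < K1" "\<forall>(X :: complex^'d^'d) (x :: complex^'d). norm (X *v x) \<le> norm X * norm x * K1"
    using bounded_bilinear.pos_bounded[OF bounded_bilinear_matrix_vector_mult[where 'd = 'd]] by auto
  obtain b where b: "0 < b" "\<forall>x\<in>\<BB>. norm x \<le> b" using bdd by (auto simp: bounded_pos)
  \<comment> \<open>The added 1 serves the part of the window where the solution is still the datum
    itself.\<close>
  define C0 where "C0 = C * b * K1\<^sup>2 + 1"
  have C0: "1 \<le> C0" using C b K1 by (simp add: C0_def)
  \<comment> \<open>The middle factor pays for the gap of up to \<open>2 * V\<close> between
    \<open>T\<close> and the delay of a contributing word.\<close>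
  define D where "D T = C0 * exp (2 * a + 2 * \<bar>\<nu>\<bar> * V) * exp (\<gamma> * T)" for T
  have D0: "0 \<le> D T" for T using C0 by (simp add: D_def)
  \<comment> \<open>The degree in \<open>N\<close> of the bound for \<open>card I\<close> squared;
    this power is absorbed into \<open>exp (\<epsilon> * T)\<close>.\<close>
  define k where "k = 2 * (M + 1)"
  define K where "K = C0 * exp (2 * a + 2 * \<bar>\<nu>\<bar> * V) * ((real M + 1)\<^sup>2 * (fact k * exp (\<epsilon> * w) / (\<epsilon> * w) ^ k))"
  have "0 < K" using C0 \<epsilon> w by (auto simp: K_def intro!: mult_pos_pos divide_pos_pos zero_less_power)
  moreover have "Xnorm p L (history u T) \<le> ennreal (K * exp ((\<gamma> + \<epsilon>) * T)) * Xnorm p L u0"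
    if A: "A \<in> Linf_valued \<BB>" and u0: "u0 \<in> Xspace p L" and sol: "is_solution L A u0 u" and T: "0 \<le> T"
    for A u0 u T
  proof -
    define N where "N = Suc (nat \<lfloor>T / w\<rfloor>)"
    have N: "T < real N * w" "real N \<le> T / w + 1"
    proof -
      have "T / w < real N" unfolding N_def by linarith
      then show "T < real N * w" using w by (simp add: pos_divide_less_eq)
      show "real N \<le> T / w + 1" using T w by (simp add: N_def)
    qed
    \<comment> \<open>One translate per term of the solution formula; \<open>None\<close> stands for
      the datum itself, seen in the window while \<open>T\<close> is small.\<close>
    define I where "I = insert None (Some ` (SIGMA k:{..<N}. shell \<Lambda> k \<times> (UNIV :: 'n set)))"
    have finI: "finite (SIGMA k:{..<N}. shell \<Lambda> k \<times> (UNIV :: 'n set))" by auto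
    define s where "s i = (case i of None \<Rightarrow> - T | Some (k, r, j) \<Rightarrow> l r + L $ j - T)"
      for i :: "(nat \<times> real \<times> 'n) option"
    define g where "g x = indicator {- V..<0} x * norm (u0 x)" for x
    have g0: "0 \<le> g x" for x by (simp add: g_def)
    have sumI: "(\<Sum>i\<in>I. h i) = h None + (\<Sum>k<N. \<Sum>r\<in>shell \<Lambda> k. \<Sum>j\<in>UNIV. h (Some (k, r, j)))"
      for h :: "_ \<Rightarrow> real"
      unfolding I_def using finI sum.Sigma[of "{..<N}" "\<lambda>k. shell \<Lambda> k \<times> UNIV" "\<lambda>k x. h (Some (k, x))"]
      by (subst sum.insert) (auto simp: sum.reindex case_prod_unfold sum.cartesian_product)
    have "real (card I) = 1 + (\<Sum>k<N. real (card (shell \<Lambda> k)) * real M)"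
      using sumI[of "\<lambda>_. 1"] by (simp add: M_def)
    also have "\<dots> \<le> 1 + (\<Sum>k<N. real N ^ M * real M)"
    proof (intro add_left_mono sum_mono mult_right_mono)
      fix k assume "k \<in> {..<N}"
      then have "card (shell \<Lambda> k) \<le> N ^ M"
        using order_trans[OF card_shell_le[of \<Lambda> k] power_mono[of "Suc k" N]] by (simp add: M_def)
      then show "real (card (shell \<Lambda> k)) \<le> real N ^ M" by (metis of_nat_le_iff of_nat_power)
    qed simp
    also have "\<dots> \<le> (real M + 1) * real N ^ (M + 1)"
      using one_le_power[of "real N" "M + 1"] by (simp add: algebra_simps N_def)
    finally have cardI: "real (card I) \<le> (real M + 1) * real N ^ (M + 1)" .
    have "(\<epsilon> * w * real N) ^ k \<le> fact k * exp (\<epsilon> * w * real N)"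
      using \<epsilon> w by (intro power_le_fact_mult_exp) simp
    also have "\<dots> \<le> fact k * (exp (\<epsilon> * w) * exp (\<epsilon> * T))"
    proof (intro mult_left_mono)
      have "\<epsilon> * w * real N \<le> \<epsilon> * w * (T / w + 1)" using N \<epsilon> w by (intro mult_left_mono) auto
      also have "\<dots> = \<epsilon> * w + \<epsilon> * T" using w by (simp add: field_simps)
      finally show "exp (\<epsilon> * w * real N) \<le> exp (\<epsilon> * w) * exp (\<epsilon> * T)" by (simp add: exp_add[symmetric])
    qed simp
    finally have powN: "real N ^ k \<le> fact k * exp (\<epsilon> * w) / (\<epsilon> * w) ^ k * exp (\<epsilon> * T)"
      using \<epsilon> w by (simp add: power_mult_distrib pos_le_divide_eq mult.commute mult.left_commute)
    have "real (card I) ^ 2 \<le> ((real M + 1) * real N ^ (M + 1)) ^ 2"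
      by (intro power_mono cardI) simp
    also have "\<dots> = (real M + 1)\<^sup>2 * real N ^ k"
      by (simp add: power_mult_distrib power_mult[symmetric] k_def mult.commute del: power_Suc)
    also have "\<dots> \<le> (real M + 1)\<^sup>2 * (fact k * exp (\<epsilon> * w) / (\<epsilon> * w) ^ k * exp (\<epsilon> * T))"
      by (intro mult_left_mono powN) simp
    finally have "D T * real (card I) ^ 2 \<le>
        D T * ((real M + 1)\<^sup>2 * (fact k * exp (\<epsilon> * w) / (\<epsilon> * w) ^ k * exp (\<epsilon> * T)))"
      by (intro mult_left_mono D0)
    also have "\<dots> = K * (exp (\<gamma> * T) * exp (\<epsilon> * T))"
      by (simp only: D_def K_def ac_simps times_divide_eq_left times_divide_eq_right)
    also have "\<dots> = K * exp ((\<gamma> + \<epsilon>) * T)" by (simp add: exp_add[symmetric] algebra_simps)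
    finally have DK: "D T * real (card I) ^ 2 \<le> K * exp ((\<gamma> + \<epsilon>) * T)" .
    have pointwise: "norm (u t) \<le> D T * (\<Sum>i\<in>I. g (t - T - s i))" if t: "- V \<le> t - T" "t < T" for t
    proof (cases "t < 0")
      case True
      have "- V \<le> t" using t T by simp
      then have "u t = u0 t" using sol True by (simp add: is_solution_def V_def)
      then have "norm (u t) = g t" using True \<open>- V \<le> t\<close> by (simp add: g_def)
      also have "\<dots> \<le> (\<Sum>i\<in>I. g (t - T - s i))"
        unfolding sumI by (simp add: s_def add_increasing2 sum_nonneg g0)
      also have "\<dots> \<le> D T * (\<Sum>i\<in>I. g (t - T - s i))"
      proof -
        \<comment> \<open>Here the window still meets negative times, so \<open>T\<close> is bounded
          and the constants in \<open>D T\<close> keep it at least 1.\<close>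
        have "T \<le> V" using True t by simp
        have "- \<bar>\<nu>\<bar> * V \<le> - \<bar>\<nu>\<bar> * T" using \<open>T \<le> V\<close> by (simp add: mult_left_mono)
        also have "\<dots> \<le> \<nu> * T" using T by (intro mult_right_mono) auto
        finally have "- (\<bar>\<nu>\<bar> * V) \<le> \<nu> * T" by simp
        moreover have "a / V * T \<le> a" using \<open>T \<le> V\<close> V a by (simp add: field_simps)
        moreover have "0 \<le> \<bar>\<nu>\<bar> * V" using V by simp
        ultimately have "0 \<le> 2 * a + 2 * \<bar>\<nu>\<bar> * V + \<gamma> * T" using a by (simp add: \<gamma> algebra_simps)
        then have "1 * 1 \<le> C0 * exp (2 * a + 2 * \<bar>\<nu>\<bar> * V + \<gamma> * T)" using C0 by (intro mult_mono) auto
        then have "1 \<le> D T" by (simp add: D_def exp_add mult.assoc)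
        then show ?thesis using mult_right_mono[of 1 "D T"] g0 by (simp add: sum_nonneg)
      qed
      finally show ?thesis .
    next
      case False
      have "t < real N * vmin L" using t N by (simp add: w_def)
      note formula = solution_formula[OF L pos sol _ this, folded l_def]
      define c where "c = coef \<Lambda> (\<lambda>r. A (t - l r))"
      have AB: "\<forall>s. A (t - l s) \<in> \<BB>" using A by (simp add: Linf_valued_def)
      have summand: "norm (if l r \<le> t \<and> t < l r + L $ j then c k r *v (A (t - l r) $ j *v u0 (t - l r - L $ j)) else 0)
        \<le> D T * g (t - l r - L $ j)" if r: "r \<in> shell \<Lambda> k" for k r j
      proof (cases "l r \<le> t \<and> t < l r + L $ j")
        case True
        have lr: "l r \<le> real k * V" unfolding l_def V_def by (rule shell_le[OF transfer_mem_shell[OF L r]])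
        have Lj: "L $ j \<le> V" by (simp add: V_def le_vmax)
        have "T / V - 2 \<le> real k"
        proof -
          have "T \<le> real k * V + 2 * V" using True lr Lj t by linarith
          then show ?thesis using V by (simp add: pos_divide_le_eq algebra_simps)
        qed
        then have "a * (T / V - 2) \<le> a * real k" using a by (intro mult_left_mono) auto
        moreover have "\<nu> * (l r - T) \<le> 2 * \<bar>\<nu>\<bar> * V"
        proof -
          have "\<bar>l r - T\<bar> \<le> 2 * V" using True Lj t by (simp add: abs_le_iff)
          then have "\<bar>\<nu>\<bar> * \<bar>l r - T\<bar> \<le> \<bar>\<nu>\<bar> * (2 * V)" by (intro mult_left_mono) auto
          then show ?thesis using abs_ge_self[of "\<nu> * (l r - T)"] by (simp add: abs_mult)
        qed
        ultimately have ex: "- (a * real k) + \<nu> * l r \<le> 2 * a + 2 * \<bar>\<nu>\<bar> * V + \<gamma> * T"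
          by (simp add: \<gamma> algebra_simps)
        have "\<rho> = exp (- a)" using \<rho> by (simp add: a_def)
        then have \<rho>k: "\<rho> ^ k = exp (- (a * real k))" by (simp add: exp_of_nat_mult[symmetric] mult.commute)
        have "norm (c k r) \<le> C * \<rho> ^ k * exp (\<nu> * l r)"
          unfolding c_def l_def by (rule coef[OF AB[unfolded l_def] r])
        also have "\<dots> = C * exp (- (a * real k) + \<nu> * l r)" unfolding \<rho>k exp_add by (simp only: mult.assoc)
        also have "\<dots> \<le> C * exp (2 * a + 2 * \<bar>\<nu>\<bar> * V + \<gamma> * T)" using C ex by simp
        finally have ck: "norm (c k r) \<le> C * exp (2 * a + 2 * \<bar>\<nu>\<bar> * V + \<gamma> * T)" .
        let ?x = "u0 (t - l r - L $ j)"
        have Aj: "norm (A (t - l r) $ j) \<le> b"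
          using order_trans[OF Finite_Cartesian_Product.norm_nth_le] b AB by blast
        have "norm (A (t - l r) $ j *v ?x) \<le> norm (A (t - l r) $ j) * norm ?x * K1" using K1 by blast
        also have "\<dots> \<le> b * norm ?x * K1" using Aj K1 by (intro mult_right_mono) auto
        finally have Ax: "norm (A (t - l r) $ j *v ?x) \<le> b * norm ?x * K1" .
        have "norm (c k r *v (A (t - l r) $ j *v ?x)) \<le> norm (c k r) * norm (A (t - l r) $ j *v ?x) * K1"
          using K1 by blast
        also have "\<dots> \<le> (C * exp (2 * a + 2 * \<bar>\<nu>\<bar> * V + \<gamma> * T)) * (b * norm ?x * K1) * K1"
          using ck Ax K1 C by (intro mult_right_mono mult_mono) auto
        also have "\<dots> = (C * b * K1\<^sup>2) * exp (2 * a + 2 * \<bar>\<nu>\<bar> * V + \<gamma> * T) * norm ?x"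
          by (simp add: power2_eq_square ac_simps)
        also have "\<dots> \<le> C0 * exp (2 * a + 2 * \<bar>\<nu>\<bar> * V + \<gamma> * T) * norm ?x"
          by (intro mult_right_mono) (auto simp: C0_def)
        also have "\<dots> = D T * g (t - l r - L $ j)"
          using True Lj by (simp add: D_def g_def exp_add mult.assoc)
        finally show ?thesis using True by simp
      qed (auto simp: D0 g0)
      have "norm (u t) \<le> (\<Sum>k<N. \<Sum>r\<in>shell \<Lambda> k. \<Sum>j\<in>UNIV. D T * g (t - l r - L $ j))"
        unfolding formula[OF leI[OF False]]
        by (intro order_trans[OF norm_sum] sum_mono summand[unfolded c_def])
      also have "\<dots> \<le> D T * (\<Sum>i\<in>I. g (t - T - s i))"
        unfolding sumI by (simp add: s_def distrib_left sum_distrib_left D0 g0 diff_diff_eq2 diff_diff_eq)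
      finally show ?thesis .
    qed
    have "Xnorm p L (history u T) \<le> ennreal (D T * real (card I) ^ 2) * Xnorm p L u0"
    proof (rule Xnorm_le_of_shift_bound[OF p u0])
      show "finite I" "I \<noteq> {}" "0 \<le> D T" using finI D0 by (auto simp: I_def)
      show "history u T \<in> borel_measurable (lebesgue_on {- vmax L..<0})"
        using A u0 by (intro solution_measurable[OF pos sol _ _ T]) (auto simp: Linf_valued_def Xspace_def)
      fix x assume "x \<in> {- vmax L..<0}"
      then show "norm (history u T x) \<le>
          D T * (\<Sum>i\<in>I. indicator {- vmax L..<0} (x - s i) * norm (u0 (x - s i)))"
        using pointwise[of "x + T"] by (simp add: history_def g_def V_def)
    qed
    also have "\<dots> \<le> ennreal (K * exp ((\<gamma> + \<epsilon>) * T)) * Xnorm p L u0"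
      by (intro mult_right_mono ennreal_leI DK) simp
    finally show ?thesis .
  qed
  ultimately show "\<exists>K>0. \<forall>A\<in>Linf_valued \<BB>. \<forall>u0\<in>Xspace p L. \<forall>u. is_solution L A u0 u \<longrightarrow>
      (\<forall>t\<ge>0. Xnorm p L (history u t) \<le> ennreal (K * exp ((\<nu> + ln \<rho> / vmax L + \<epsilon>) * t)) * Xnorm p L u0)"
    unfolding \<gamma>_def by blast
qed

lemma ln_ext_le:
  assumes "0 < y" "x \<le> ennreal y"
  shows "ln_ext x \<le> ereal (ln y)"
proof (cases "x = 0")
  case False
  then obtain z where z: "x = ennreal z" "0 < z"
    using assms(2) by (cases x) (auto simp: top_unique less_le)
  then show ?thesis using assms by (simp add: ln_ext_def)
qed (simp add: ln_ext_def)

lemma lyap_exp_le: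
  assumes "exp_type p L \<A> \<gamma>"
  shows "lyap_exp p L \<A> \<le> ereal \<gamma>"
proof -
  have "lyap_exp p L \<A> \<le> ereal \<gamma> + ereal e" if "0 < e" for e :: real
  proof -
    note e = that
    then obtain K where K: "0 < K" "\<forall>A\<in>\<A>. \<forall>u0\<in>Xspace p L. \<forall>u. is_solution L A u0 u \<longrightarrow>
        (\<forall>t\<ge>0. Xnorm p L (history u t) \<le> ennreal (K * exp ((\<gamma> + e / 2) * t)) * Xnorm p L u0)"
      \<comment> \<open>Half of \<open>e\<close> goes into the exponential type; the other half
        absorbs \<open>ln K / t\<close> for large \<open>t\<close>.\<close>
      using assms[unfolded exp_type_def, rule_format, of "e / 2"] by auto
    have "eventually (\<lambda>t::real. (SUP A\<in>\<A>. SUP u\<in>{u. \<exists>u0\<in>Xspace p L. Xnorm p L u0 = 1 \<and> is_solution L A u0 u}.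
       ln_ext (Xnorm p L (history u t)) / ereal t) \<le> ereal (\<gamma> + e)) at_top"
      using eventually_gt_at_top[of 0] eventually_ge_at_top[of "2 * ln K / e"]
    proof eventually_elim
      case (elim t)
      show ?case
      proof (intro SUP_least)
        fix A u assume A: "A \<in> \<A>" and "u \<in> {u. \<exists>u0\<in>Xspace p L. Xnorm p L u0 = 1 \<and> is_solution L A u0 u}"
        then obtain u0 where u0: "u0 \<in> Xspace p L" "Xnorm p L u0 = 1" "is_solution L A u0 u" by blast
        have "Xnorm p L (history u t) \<le> ennreal (K * exp ((\<gamma> + e / 2) * t)) * Xnorm p L u0"
          using elim(1) by (intro K(2)[rule_format, OF A u0(1,3)]) simp
        then have "ln_ext (Xnorm p L (history u t)) \<le> ereal (ln (K * exp ((\<gamma> + e / 2) * t)))"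
          using K(1) u0(2) by (intro ln_ext_le) simp_all
        then have "ln_ext (Xnorm p L (history u t)) / ereal t \<le> ereal (ln (K * exp ((\<gamma> + e / 2) * t))) / ereal t"
          using elim(1) by (intro ereal_divide_right_mono) auto
        also have "\<dots> = ereal (ln (K * exp ((\<gamma> + e / 2) * t)) / t)" using elim(1) by simp
        also have "\<dots> \<le> ereal (\<gamma> + e)"
        proof -
          have "ln (K * exp ((\<gamma> + e / 2) * t)) = ln K + (\<gamma> + e / 2) * t" using K(1) by (simp add: ln_mult)
          moreover have "ln K \<le> e / 2 * t" using elim(2) e by (simp add: field_simps)
          ultimately have "ln (K * exp ((\<gamma> + e / 2) * t)) \<le> (\<gamma> + e) * t" by (simp add: algebra_simps)
          then show ?thesis using elim(1) by (simp add: pos_divide_le_eq)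
        qed
        finally show "ln_ext (Xnorm p L (history u t)) / ereal t \<le> ereal (\<gamma> + e)" .
      qed
    qed
    then show ?thesis unfolding lyap_exp_def by (auto intro: Limsup_bounded)
  qed
  then show ?thesis by (rule ereal_le_epsilon2)
qed

section \<open>Recovering the coefficients from solutions\<close>

lemma finite_real_separated:
  fixes F :: "real set"
  assumes "finite F" "0 < d"
  obtains \<delta> where "0 < \<delta>" "\<delta> \<le> d" "\<And>x y. x \<in> F \<Longrightarrow> y \<in> F \<Longrightarrow> \<bar>x - y\<bar> < \<delta> \<Longrightarrow> x = y"
proof -
  \<comment> \<open>Inserting \<open>d\<close> keeps the set nonempty and caps its minimum.\<close>
  define D where "D = insert d ((\<lambda>(x, y). \<bar>x - y\<bar>) ` {z \<in> F \<times> F. fst z \<noteq> snd z})"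
  have fin: "finite D" using assms by (simp add: D_def)
  show thesis
  proof (rule that[of "Min D"])
    show "0 < Min D" using fin assms by (subst Min_gr_iff) (auto simp: D_def)
    show "Min D \<le> d" using fin by (intro Min_le) (auto simp: D_def)
    fix x y assume xy: "x \<in> F" "y \<in> F" "\<bar>x - y\<bar> < Min D"
    show "x = y"
    proof (rule ccontr)
      assume "x \<noteq> y"
      then have "\<bar>x - y\<bar> \<in> D" using xy by (force simp: D_def)
      then show False using Min_le[OF fin] xy by fastforce
    qed
  qed
qed

text \<open>The windows \<open>{r - s - \<delta>..<r - s}\<close> are pairwise disjoint by
  separation, so at most one summand is active. The form as a finite sum of indicators makes
  \<open>A\<close> visibly measurable.\<close>

lemma piecewise_constant_values:
  fixes B :: "real \<Rightarrow> 'b::real_vector"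
  assumes F: "finite F" and sep: "\<forall>x\<in>F. \<forall>y\<in>F. \<bar>x - y\<bar> < \<delta> \<longrightarrow> x = y"
    and A_def: "A = (\<lambda>\<tau>. b0 + (\<Sum>s\<in>F. indicator {r - s - \<delta>..<r - s} \<tau> *\<^sub>R (B s - b0)))"
  shows "s \<in> F \<Longrightarrow> \<tau> \<in> {r - s - \<delta>..<r - s} \<Longrightarrow> A \<tau> = B s"
    and "\<forall>s\<in>F. \<tau> \<notin> {r - s - \<delta>..<r - s} \<Longrightarrow> A \<tau> = b0"
proof -
  assume s: "s \<in> F" "\<tau> \<in> {r - s - \<delta>..<r - s}"
  have "(\<Sum>s'\<in>F. indicator {r - s' - \<delta>..<r - s'} \<tau> *\<^sub>R (B s' - b0)) = (\<Sum>s'\<in>F. if s' = s then B s - b0 else 0)"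
  proof (rule sum.cong[OF refl])
    fix s' assume s': "s' \<in> F"
    show "indicator {r - s' - \<delta>..<r - s'} \<tau> *\<^sub>R (B s' - b0) = (if s' = s then B s - b0 else 0)"
    proof (cases "\<tau> \<in> {r - s' - \<delta>..<r - s'}")
      case True
      then have "\<bar>s' - s\<bar> < \<delta>" using s(2) by (simp add: abs_less_iff)
      then have "s' = s" using sep s' s(1) by blast
      then show ?thesis using True by simp
    next
      case False
      then have "s' \<noteq> s" using s(2) by blast
      then show ?thesis using False by simp
    qed
  qed
  then show "A \<tau> = B s" using F s by (simp add: A_def)
next
  assume "\<forall>s\<in>F. \<tau> \<notin> {r - s - \<delta>..<r - s}"
  then have "(\<Sum>s\<in>F. indicator {r - s - \<delta>..<r - s} \<tau> *\<^sub>R (B s - b0)) = 0"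
    by (intro sum.neutral) simp
  then show "A \<tau> = b0" by (simp add: A_def)
qed

text \<open>
  The initial datum is concentrated on \<open>[-\<delta>, 0)\<close>, with \<open>\<delta>\<close> below the gaps between the relevant total delays:
  at times just before \<open>r\<close> only the words of total delay \<open>r\<close> contribute, and all of them have length \<open>n\<close>.
\<close>

lemma impulse_response:
  fixes \<Lambda> :: "real^'n" and \<BB> :: "(complex^'d^'d^'n) set"
  assumes pos: "\<And>j. 0 < \<Lambda> $ j" and ones: "(\<chi> j. 1) \<in> Vset \<Lambda>" and ne: "\<BB> \<noteq> {}"
    and B: "\<forall>k<n. \<forall>s\<in>shell \<Lambda> k. B s \<in> \<BB>"
    and n: "1 \<le> n" and r: "r \<in> shell \<Lambda> n"
  obtains A \<delta> where "A \<in> Linf_valued \<BB>" "0 < \<delta>" "\<delta> \<le> vmax \<Lambda>"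
    "\<And>y u t. is_solution \<Lambda> A (\<lambda>x. indicator {- \<delta>..<0} x *\<^sub>R y) u \<Longrightarrow> r - \<delta> \<le> t \<Longrightarrow> t < r \<Longrightarrow>
      u t = coef \<Lambda> B n r *v y"
proof -
  interpret M: bounded_bilinear "(*v) :: complex^'d^'d \<Rightarrow> complex^'d \<Rightarrow> complex^'d"
    by (rule bounded_bilinear_matrix_vector_mult)
  have w: "0 < vmin \<Lambda>" by (rule vmin_pos[OF pos])
  obtain N0 :: nat where "r < real N0 * vmin \<Lambda>" using reals_Archimedean3[OF w] by blast
  define N where "N = max n N0"
  have "real N0 * vmin \<Lambda> \<le> real N * vmin \<Lambda>" using w by (simp add: N_def)
  then have N: "n \<le> N" "r < real N * vmin \<Lambda>" using \<open>r < real N0 * vmin \<Lambda>\<close> by (auto simp: N_def)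
  \<comment> \<open>The last shell is included because a word of length \<open>k < N\<close> is
    still extended by one letter before it reads the datum.\<close>
  define F' where "F' = (\<Union>k\<le>N. shell \<Lambda> k)"
  have F'I: "k \<le> N \<Longrightarrow> s \<in> shell \<Lambda> k \<Longrightarrow> s \<in> F'" for k s by (auto simp: F'_def)
  have "finite F'" by (simp add: F'_def)
  \<comment> \<open>Capping \<open>\<delta>\<close> by \<open>vmin \<Lambda>\<close> makes the
    impulse shorter than every delay, so the last letter of a word of total delay \<open>r\<close>
    is the one that crosses time 0.\<close>
  from finite_real_separated[OF this w]
  obtain \<delta> where \<delta>: "0 < \<delta>" "\<delta> \<le> vmin \<Lambda>"
    and sep: "\<And>x y. x \<in> F' \<Longrightarrow> y \<in> F' \<Longrightarrow> \<bar>x - y\<bar> < \<delta> \<Longrightarrow> x = y" by blast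
  obtain b0 where b0: "b0 \<in> \<BB>" using ne by blast
  define F where "F = (\<Union>k<n. shell \<Lambda> k)"
  have "k \<le> N" if "k < n" for k using that N(1) by simp
  then have F: "finite F" "F \<subseteq> F'" using F'I by (auto simp: F_def)
  have sepF: "\<forall>x\<in>F. \<forall>y\<in>F. \<bar>x - y\<bar> < \<delta> \<longrightarrow> x = y" using sep F by blast
  define A where "A = (\<lambda>\<tau>. b0 + (\<Sum>s\<in>F. indicator {r - s - \<delta>..<r - s} \<tau> *\<^sub>R (B s - b0)))"
  note A_val = piecewise_constant_values[OF F(1) sepF A_def]
  show thesis
  proof (rule that[of A \<delta>])
    have "A \<tau> \<in> \<BB>" for \<tau>
    proof (cases "\<exists>s\<in>F. \<tau> \<in> {r - s - \<delta>..<r - s}")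
      case True
      then obtain s where s: "s \<in> F" "\<tau> \<in> {r - s - \<delta>..<r - s}" by blast
      then have "A \<tau> = B s" by (rule A_val(1))
      then show ?thesis using s(1) B by (auto simp: F_def)
    next
      case False
      then show ?thesis using A_val(2) b0 by simp
    qed
    moreover have "A \<in> borel_measurable lebesgue"
      unfolding A_def
      by (intro borel_measurable_add borel_measurable_sum borel_measurable_scaleR borel_measurable_indicator) auto
    ultimately show "A \<in> Linf_valued \<BB>" by (simp add: Linf_valued_def)
    show "0 < \<delta>" by (rule \<delta>)
    show "\<delta> \<le> vmax \<Lambda>" using \<delta>(2) vmin_le[of \<Lambda> undefined] le_vmax[of \<Lambda> undefined] by linarith
    fix y u t
    assume sol: "is_solution \<Lambda> A (\<lambda>x. indicator {- \<delta>..<0} x *\<^sub>R y) u" and t: "r - \<delta> \<le> t" "t < r"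
    define l where "l = transfer \<Lambda> \<Lambda>"
    have l: "l s = s" if "s \<in> shell \<Lambda> k" for s k unfolding l_def by (rule transfer_self[OF that])
    define c where "c = coef \<Lambda> (\<lambda>s. A (t - l s))"
    obtain m where m: "n = Suc m" using n by (cases n) auto
    have "vmin \<Lambda> \<le> real n * vmin \<Lambda>" using n w by simp
    then have "0 \<le> t" using shell_ge[OF r] \<delta> t by linarith
    moreover have "t < real N * vmin \<Lambda>" using N t by simp
    ultimately have "u t = (\<Sum>k<N. \<Sum>s\<in>shell \<Lambda> k. \<Sum>j\<in>UNIV. if l s \<le> t \<and> t < l s + \<Lambda> $ j
      then c k s *v (A (t - l s) $ j *v (indicator {- \<delta>..<0} (t - l s - \<Lambda> $ j) *\<^sub>R y)) else 0)"
      unfolding c_def l_def by (rule solution_formula[OF self_mem_Vset pos sol])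
    also have "\<dots> = (\<Sum>k<N. if k = m then \<Sum>s\<in>shell \<Lambda> k. \<Sum>j\<in>UNIV. if s + \<Lambda> $ j = r
      then (c k s ** A (t - l s) $ j) *v y else 0 else 0)"
    proof (rule sum.cong[OF refl])
      fix k assume k: "k \<in> {..<N}"
      have "(if l s \<le> t \<and> t < l s + \<Lambda> $ j
          then c k s *v (A (t - l s) $ j *v (indicator {- \<delta>..<0} (t - l s - \<Lambda> $ j) *\<^sub>R y)) else 0) =
        (if k = m \<and> s + \<Lambda> $ j = r then (c k s ** A (t - l s) $ j) *v y else 0)" if s: "s \<in> shell \<Lambda> k" for s j
      proof (cases "s + \<Lambda> $ j = r")
        case True
        have "s + \<Lambda> $ j \<in> shell \<Lambda> (Suc k)" using s by auto
        \<comment> \<open>The hypothesis on the all-ones vector enters here: words of another length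
          cannot have total delay \<open>r\<close> and blur the coefficient.\<close>
        then have "Suc k = n" using shell_disjoint[OF ones r, of "Suc k"] True by auto
        moreover have "\<delta> \<le> \<Lambda> $ j" using \<delta>(2) vmin_le[of \<Lambda> j] by simp
        ultimately show ?thesis using True t m
          by (auto simp: l[OF s] matrix_vector_mul_assoc indicator_def)
      next
        case False
        have "s + \<Lambda> $ j \<in> F'" using s k by (intro F'I[of "Suc k"]) auto
        \<comment> \<open>Any other total delay is at least \<open>\<delta>\<close> away from
          \<open>r\<close>, so it reads the datum outside the impulse; the half-open intervals
          settle the borderline case.\<close>
        then have "\<not> \<bar>r - (s + \<Lambda> $ j)\<bar> < \<delta>" using sep[of r] F'I[OF N(1) r] False by auto
        then have "t - s - \<Lambda> $ j \<notin> {- \<delta>..<0}" using t by auto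
        then have "indicator {- \<delta>..<0} (t - s - \<Lambda> $ j) = (0 :: real)" by (rule indicator_simps(2))
        then show ?thesis using False by (simp add: l[OF s])
      qed
      then show "(\<Sum>s\<in>shell \<Lambda> k. \<Sum>j\<in>UNIV. if l s \<le> t \<and> t < l s + \<Lambda> $ j
          then c k s *v (A (t - l s) $ j *v (indicator {- \<delta>..<0} (t - l s - \<Lambda> $ j) *\<^sub>R y)) else 0) =
        (if k = m then \<Sum>s\<in>shell \<Lambda> k. \<Sum>j\<in>UNIV. if s + \<Lambda> $ j = r
          then (c k s ** A (t - l s) $ j) *v y else 0 else 0)"
        by simp
    qed
    also have "\<dots> = (\<Sum>s\<in>shell \<Lambda> m. \<Sum>j\<in>UNIV. if s + \<Lambda> $ j = r then (c m s ** A (t - l s) $ j) *v y else 0)"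
      using N m by (simp add: sum.delta)
    also have "\<dots> = (\<Sum>s\<in>shell \<Lambda> (Suc m). if s = r then c (Suc m) s *v y else 0)"
      unfolding c_def by (rule sum_shell_coef_Suc[symmetric, where F = "\<lambda>s X. if s = r then X *v y else 0"])
        (simp add: Modules.additive_def M.add_left)
    also have "\<dots> = c n r *v y"
      using r unfolding m[symmetric] by (simp add: sum.delta)
    also have "c n r = coef \<Lambda> B n r"
      unfolding c_def
    proof (rule coef_cong)
      fix k s assume k: "k < n" and s: "s \<in> shell \<Lambda> k"
      then have "s \<in> F" by (auto simp: F_def)
      then have "A (t - s) = B s" by (rule A_val(1)) (use t in auto)
      then show "A (t - l s) = B s" by (simp add: l[OF s])
    qed
    finally show "u t = coef \<Lambda> B n r *v y" .
  qed
qed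

section \<open>Norms of impulses\<close>

text \<open>The \<open>L\<^sup>p\<close> norm of the indicator function of \<open>[-\<delta>, 0)\<close>.\<close>

definition impulse_norm :: "ennreal \<Rightarrow> real \<Rightarrow> real" where
  "impulse_norm p \<delta> = (if p = \<infinity> then 1 else \<delta> powr (1 / enn2real p))"

lemma impulse_norm_pos: "0 < \<delta> \<Longrightarrow> 0 < impulse_norm p \<delta>"
  by (simp add: impulse_norm_def)

lemma Xnorm_ge_impulse_norm:
  fixes L :: "real^'n" and f :: "real \<Rightarrow> complex^'d"
  assumes p: "1 \<le> p" and \<delta>: "0 < \<delta>" "\<delta> \<le> vmax L" and f: "\<And>x. - \<delta> \<le> x \<Longrightarrow> x < 0 \<Longrightarrow> f x = z"
  shows "ennreal (norm z * impulse_norm p \<delta>) \<le> Xnorm p L f"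
proof (cases "p = \<infinity>")
  case True
  let ?S = "esssup (lebesgue_on {- vmax L..<0}) (\<lambda>x. ennreal (norm (f x)))"
  have "ennreal (norm z) \<le> ?S"
  proof (rule ccontr)
    assume *: "\<not> ennreal (norm z) \<le> ?S"
    have "AE x in lebesgue_on {- vmax L..<0}. ennreal (norm (f x)) \<le> ?S" by (rule esssup_AE)
    then have "AE x in lebesgue. x \<in> {- vmax L..<0} \<longrightarrow> ennreal (norm (f x)) \<le> ?S"
      by (subst (asm) AE_restrict_space_iff) auto
    then have "AE x in lebesgue. x \<notin> {- \<delta>..<0}"
      by eventually_elim (use * f \<delta> in auto)
    \<comment> \<open>A smaller essential supremum would make an interval of length
      \<open>\<delta>\<close> negligible.\<close>
    then have "{- \<delta>..<0} \<in> null_sets lebesgue" by (subst AE_iff_null_sets) auto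
    then show False using \<delta> by (auto simp: null_sets_def)
  qed
  then show ?thesis using True by (simp add: Xnorm_def Lp_norm_def impulse_norm_def)
next
  case False
  define q where "q = enn2real p"
  have q: "1 \<le> q" unfolding q_def by (rule enn2real_ge_1[OF p False])
  define J where "J = (\<integral>\<^sup>+x. ennreal (norm (f x) powr q) \<partial>lebesgue_on {- vmax L..<0})"
  have XJ: "Xnorm p L f = (if J = \<infinity> then \<infinity> else ennreal (enn2real J powr (1 / q)))"
    using False by (simp add: Xnorm_def Lp_norm_def J_def q_def Let_def)
  have "ennreal (norm z powr q * \<delta>) = (\<integral>\<^sup>+x. ennreal (norm z powr q) * indicator {- \<delta>..<0} x \<partial>lebesgue)"
    using \<delta> by (subst nn_integral_cmult_indicator) (auto simp: ennreal_mult)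
  also have "\<dots> \<le> (\<integral>\<^sup>+x. ennreal (norm (f x) powr q) * indicator {- vmax L..<0} x \<partial>lebesgue)"
    using \<delta> f by (intro nn_integral_mono) (auto simp: indicator_def)
  also have "\<dots> = J" unfolding J_def by (subst nn_integral_restrict_space) auto
  finally have J: "ennreal (norm z powr q * \<delta>) \<le> J" .
  show ?thesis
  proof (cases "J = \<infinity>")
    case Jfin: False
    then have "norm z powr q * \<delta> \<le> enn2real J"
      using J \<delta> by (cases J) (auto simp: enn2real_ennreal)
    then have "(norm z powr q * \<delta>) powr (1 / q) \<le> enn2real J powr (1 / q)"
      using q \<delta> by (intro powr_mono2) auto
    also have "(norm z powr q * \<delta>) powr (1 / q) = norm z * \<delta> powr (1 / q)"
      using q \<delta> by (simp add: powr_mult powr_powr)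
    finally show ?thesis using Jfin False by (simp add: XJ impulse_norm_def q_def ennreal_leI)
  qed (simp add: XJ)
qed

lemma impulse_measurable:
  fixes y :: "complex^'d" and S :: "real set"
  shows "(\<lambda>x. indicator {- \<delta>..<0} x *\<^sub>R y) \<in> borel_measurable (lebesgue_on S)"
  by (intro measurable_restrict_space1 borel_measurable_scaleR borel_measurable_indicator) auto

lemma Xnorm_impulse:
  fixes L :: "real^'n" and y :: "complex^'d"
  assumes p: "1 \<le> p" and \<delta>: "0 < \<delta>" "\<delta> \<le> vmax L"
  shows "Xnorm p L (\<lambda>x. indicator {- \<delta>..<0} x *\<^sub>R y) = ennreal (norm y * impulse_norm p \<delta>)"
proof (rule antisym)
  show "ennreal (norm y * impulse_norm p \<delta>) \<le> Xnorm p L (\<lambda>x. indicator {- \<delta>..<0} x *\<^sub>R y)"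
    by (rule Xnorm_ge_impulse_norm[OF assms]) simp
  show "Xnorm p L (\<lambda>x. indicator {- \<delta>..<0} x *\<^sub>R y) \<le> ennreal (norm y * impulse_norm p \<delta>)"
  proof (cases "p = \<infinity>")
    case True
    have "(\<lambda>x. ennreal (norm (indicator {- \<delta>..<0} x *\<^sub>R y))) \<in> borel_measurable (lebesgue_on {- vmax L..<0})"
      by (rule measurable_compose[OF impulse_measurable]) simp
    then show ?thesis using True
      by (auto simp: Xnorm_def Lp_norm_def impulse_norm_def indicator_def intro!: esssup_I AE_I2 ennreal_leI)
  next
    case False
    define q where "q = enn2real p"
    have q: "1 \<le> q" unfolding q_def by (rule enn2real_ge_1[OF p False])
    define J where "J = (\<integral>\<^sup>+x. ennreal (norm (indicator {- \<delta>..<0} x *\<^sub>R y) powr q) \<partial>lebesgue_on {- vmax L..<0})"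
    have "J = (\<integral>\<^sup>+x. ennreal (norm (indicator {- \<delta>..<0} x *\<^sub>R y) powr q) * indicator {- vmax L..<0} x \<partial>lebesgue)"
      unfolding J_def by (subst nn_integral_restrict_space) auto
    also have "\<dots> = (\<integral>\<^sup>+x. ennreal (norm y powr q) * indicator {- \<delta>..<0} x \<partial>lebesgue)"
      using \<delta> q by (intro nn_integral_cong) (auto simp: indicator_def)
    also have "\<dots> = ennreal (norm y powr q * \<delta>)"
      using \<delta> by (subst nn_integral_cmult_indicator) (auto simp: ennreal_mult)
    finally have "J = ennreal (norm y powr q * \<delta>)" .
    moreover have "(norm y powr q * \<delta>) powr (1 / q) = norm y * \<delta> powr (1 / q)"
      using q \<delta> by (simp add: powr_mult powr_powr)
    moreover have "Xnorm p L (\<lambda>x. indicator {- \<delta>..<0} x *\<^sub>R y) =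
        (if J = \<infinity> then \<infinity> else ennreal (enn2real J powr (1 / q)))"
      by (simp only: Xnorm_def Lp_norm_def J_def q_def Let_def False if_False)
    ultimately show ?thesis
      using False \<delta> by (simp add: impulse_norm_def q_def)
  qed
qed

section \<open>From growth of solutions back to \<open>mu_HS\<close>\<close>

lemma norm_matrix_le:
  fixes X :: "complex^'d^'d"
  assumes "\<And>e. norm (X *v e) \<le> c * norm e"
  shows "norm X \<le> real (CARD('d) * CARD('d)) * c"
proof -
  have "norm X \<le> (\<Sum>i\<in>UNIV. \<Sum>j\<in>UNIV. norm (X $ i $ j))"
    unfolding norm_vec_def by (intro order_trans[OF L2_set_le_sum] sum_mono L2_set_le_sum) (auto intro: L2_set_nonneg)
  also have "\<dots> \<le> (\<Sum>i\<in>(UNIV :: 'd set). \<Sum>j\<in>(UNIV :: 'd set). c)"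
  proof (intro sum_mono)
    fix i j
    have "(X *v axis j 1) $ i = (\<Sum>k\<in>UNIV. X $ i $ k * axis j 1 $ k)" by (simp add: matrix_vector_mult_def)
    also have "\<dots> = (\<Sum>k\<in>UNIV. if k = j then X $ i $ k else 0)" by (rule sum.cong) (auto simp: axis_def)
    finally have "norm (X $ i $ j) \<le> norm (X *v axis j 1)"
      using Finite_Cartesian_Product.norm_nth_le[of "X *v axis j 1" i] by simp
    also have "\<dots> \<le> c" using assms[of "axis j 1"] by simp
    finally show "norm (X $ i $ j) \<le> c" .
  qed
  finally show ?thesis by (simp add: mult.assoc)
qed

text \<open>Impulses turn growth into \<open>exp (\<nu>' * r)\<close> bounds on the coefficients.
  The shift by \<open>\<nu>\<close> multiplies them by \<open>exp (- \<nu> * r)\<close>, and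
  \<open>r \<ge> n * vmin \<Lambda>\<close> makes the product geometric. Normalized data and times
  from \<open>T\<close> on suit both exponential stability and the Lyapunov exponent.\<close>

lemma mu_HS_less_1_of_growth:
  fixes \<Lambda> :: "real^'n" and \<BB> :: "(complex^'d^'d^'n) set"
  assumes nrm: "is_matrix_norm nrm" and pos: "\<And>j. 0 < \<Lambda> $ j" and ones: "(\<chi> j. 1) \<in> Vset \<Lambda>"
    and ne: "\<BB> \<noteq> {}" and p: "1 \<le> p" and K: "0 < K"
    and growth: "\<And>A u0 u t. A \<in> Linf_valued \<BB> \<Longrightarrow> u0 \<in> Xspace p \<Lambda> \<Longrightarrow> Xnorm p \<Lambda> u0 = 1 \<Longrightarrow>
      is_solution \<Lambda> A u0 u \<Longrightarrow> T \<le> t \<Longrightarrow> Xnorm p \<Lambda> (history u t) \<le> ennreal (K * exp (\<nu>' * t))"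
    and "\<nu>' < \<nu>"
  shows "mu_HS nrm \<Lambda> (shifted \<Lambda> \<nu> \<BB>) < 1"
proof -
  define d where "d = real (CARD('d) * CARD('d))"
  have w: "0 < vmin \<Lambda>" by (rule vmin_pos[OF pos])
  have coef: "norm (coef \<Lambda> B n r) \<le> d * (K * exp (\<nu>' * r))"
    if B: "\<forall>k<n. \<forall>s\<in>shell \<Lambda> k. B s \<in> \<BB>" and n: "1 \<le> n" and r: "r \<in> shell \<Lambda> n" "T \<le> r" for B n r
    unfolding d_def
  proof (rule norm_matrix_le)
    fix e :: "complex^'d"
    obtain A \<delta> where A: "A \<in> Linf_valued \<BB>" and \<delta>: "0 < \<delta>" "\<delta> \<le> vmax \<Lambda>"
      and u: "\<And>y u t. is_solution \<Lambda> A (\<lambda>x. indicator {- \<delta>..<0} x *\<^sub>R y) u \<Longrightarrow> r - \<delta> \<le> t \<Longrightarrow> t < r \<Longrightarrow>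
        u t = coef \<Lambda> B n r *v y"
      using impulse_response[OF pos ones ne B n r(1)] by blast
    show "norm (coef \<Lambda> B n r *v e) \<le> K * exp (\<nu>' * r) * norm e"
    proof (cases "e = 0")
      case False
      define m where "m = impulse_norm p \<delta>"
      have m: "0 < m" unfolding m_def by (rule impulse_norm_pos[OF \<delta>(1)])
      \<comment> \<open>Normalizes the impulse in direction \<open>e\<close> to norm one.\<close>
      define \<kappa> where "\<kappa> = 1 / (norm e * m)"
      have \<kappa>: "0 < \<kappa>" using m False by (simp add: \<kappa>_def)
      define u0 where "u0 = (\<lambda>x. indicator {- \<delta>..<0} x *\<^sub>R (\<kappa> *\<^sub>R e))"
      have X1: "Xnorm p \<Lambda> u0 = 1"
        unfolding u0_def Xnorm_impulse[OF p \<delta>] m_def[symmetric] using m False by (simp add: \<kappa>_def)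
      have "u0 \<in> borel_measurable (lebesgue_on {- vmax \<Lambda>..<0})"
        unfolding u0_def by (rule impulse_measurable)
      then have u0: "u0 \<in> Xspace p \<Lambda>" using X1 by (simp add: Xspace_def)
      obtain v where v: "is_solution \<Lambda> A u0 v" using solution_exists_unique[OF pos] by blast
      have "history v r x = coef \<Lambda> B n r *v (\<kappa> *\<^sub>R e)" if "- \<delta> \<le> x" "x < 0" for x
        unfolding history_def using that v by (intro u) (auto simp: u0_def)
      then have "ennreal (norm (coef \<Lambda> B n r *v (\<kappa> *\<^sub>R e)) * m) \<le> Xnorm p \<Lambda> (history v r)"
        unfolding m_def by (rule Xnorm_ge_impulse_norm[OF p \<delta>])
      also have "\<dots> \<le> ennreal (K * exp (\<nu>' * r))" by (rule growth[OF A u0 X1 v r(2)])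
      finally have "norm (coef \<Lambda> B n r *v (\<kappa> *\<^sub>R e)) * m \<le> K * exp (\<nu>' * r)"
        using K by (simp add: ennreal_le_iff)
      moreover have "norm (coef \<Lambda> B n r *v (\<kappa> *\<^sub>R e)) * m = norm (coef \<Lambda> B n r *v e) / norm e"
        using \<kappa> m by (simp add: bounded_bilinear.scaleR_right[OF bounded_bilinear_matrix_vector_mult] \<kappa>_def)
      ultimately show ?thesis using False by (simp add: pos_divide_le_eq)
    qed simp
  qed
  \<comment> \<open>Words longer than \<open>n0\<close> have total delay beyond \<open>T\<close>,
    where the growth bound is available.\<close>
  obtain n0 :: nat where "T < real n0 * vmin \<Lambda>" using reals_Archimedean3[OF w] by blast
  define \<rho> where "\<rho> = exp (- (\<nu> - \<nu>') * vmin \<Lambda>)"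
  show ?thesis
  proof (rule mu_HS_less_1[OF nrm pos, where m = "Suc n0" and \<rho> = \<rho> and C = "d * K"])
    show "0 < \<rho>" "\<rho> < 1" "0 \<le> d * K" "1 \<le> Suc n0" using \<open>\<nu>' < \<nu>\<close> w K by (auto simp: \<rho>_def d_def mult_neg_pos)
    fix B :: "real \<Rightarrow> complex^'d^'d^'n" and n r
    assume B: "\<And>k s. k < n \<Longrightarrow> s \<in> shell \<Lambda> k \<Longrightarrow> B s \<in> shifted \<Lambda> \<nu> \<BB>"
      and n: "Suc n0 \<le> n" and r: "r \<in> shell \<Lambda> n"
    \<comment> \<open>Preimages under the shift. They are meaningful only on shells below
      \<open>n\<close>, which are the ones that \<open>coef\<close> reads.\<close>
    define B0 where "B0 s = (SOME b. b \<in> \<BB> \<and> B s = (\<chi> j. exp (- \<nu> * \<Lambda> $ j) *\<^sub>R b $ j))" for s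
    have B0: "B0 s \<in> \<BB> \<and> B s = (\<chi> j. exp (- \<nu> * \<Lambda> $ j) *\<^sub>R B0 s $ j)" if "k < n" "s \<in> shell \<Lambda> k" for k s
    proof -
      have "\<exists>b. b \<in> \<BB> \<and> B s = (\<chi> j. exp (- \<nu> * \<Lambda> $ j) *\<^sub>R b $ j)"
        using B[OF that] unfolding shifted_def by blast
      then show ?thesis unfolding B0_def by (rule someI_ex)
    qed
    have "real n0 * vmin \<Lambda> \<le> real n * vmin \<Lambda>" using n w by simp
    then have "T \<le> r" using shell_ge[OF r] \<open>T < real n0 * vmin \<Lambda>\<close> by linarith
    have "coef \<Lambda> B n r = coef \<Lambda> (\<lambda>s. \<chi> j. exp (- \<nu> * \<Lambda> $ j) *\<^sub>R B0 s $ j) n r"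
      by (rule coef_cong) (use B0 in blast)
    also have "\<dots> = exp (- \<nu> * r) *\<^sub>R coef \<Lambda> B0 n r" by (rule coef_scale)
    finally have "norm (coef \<Lambda> B n r) = exp (- \<nu> * r) * norm (coef \<Lambda> B0 n r)" by simp
    also have "\<dots> \<le> exp (- \<nu> * r) * (d * (K * exp (\<nu>' * r)))"
      using n B0 by (intro mult_left_mono coef[OF _ _ r \<open>T \<le> r\<close>]) auto
    also have "\<dots> = d * K * exp (- (\<nu> - \<nu>') * r)"
      by (simp add: exp_add[symmetric] algebra_simps flip: exp_add)
    also have "\<dots> \<le> d * K * \<rho> ^ n"
    proof (intro mult_left_mono)
      have "(\<nu> - \<nu>') * (real n * vmin \<Lambda>) \<le> (\<nu> - \<nu>') * r"
        using shell_ge[OF r] \<open>\<nu>' < \<nu>\<close> by (intro mult_left_mono) auto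
      moreover have "\<rho> ^ n = exp (- ((\<nu> - \<nu>') * (real n * vmin \<Lambda>)))"
        by (simp add: \<rho>_def exp_of_nat_mult[symmetric] algebra_simps)
      ultimately show "exp (- (\<nu> - \<nu>') * r) \<le> \<rho> ^ n" by (simp only: exp_le_cancel_iff mult_minus_left neg_le_iff_le)
    qed (use K in \<open>auto simp: d_def\<close>)
    finally show "norm (coef \<Lambda> B n r) \<le> d * K * \<rho> ^ n" .
  qed
qed

lemma le_exp_of_ln_ext_less:
  assumes "0 < t" "ln_ext x / ereal t < ereal \<nu>"
  shows "x \<le> ennreal (exp (\<nu> * t))"
proof -
  have "x \<noteq> \<infinity>" using assms by (auto simp: ln_ext_def)
  then obtain z where z: "x = ennreal z" "0 \<le> z" by (cases x) auto
  show ?thesis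
  proof (cases "z = 0")
    case False
    then have "ln z / t < \<nu>" using assms z by (simp add: ln_ext_def)
    then have "ln z < \<nu> * t" using assms(1) by (simp add: pos_divide_less_eq)
    then have "z < exp (\<nu> * t)" using z False by (metis exp_less_mono exp_ln less_le)
    then show ?thesis using z by (simp add: ennreal_leI)
  qed (simp add: z)
qed

section \<open>The implications and the formula for the Lyapunov exponent\<close>

theorem corollary3p35:
  fixes nrm :: "complex^'d^'d \<Rightarrow> real"
    and \<Lambda> :: "real^'n"
    and \<BB> :: "(complex^'d^'d^'n) set"
  assumes "is_matrix_norm nrm"
    and "\<forall>j. 0 < \<Lambda> $ j"
    and "\<BB> \<noteq> {}"
    and "bounded \<BB>"
  shows "(mu_HS nrm \<Lambda> \<BB> < 1 \<longrightarrow>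
            (\<forall>L\<in>Vplus \<Lambda>. \<forall>p\<ge>1. exp_stable p L (Linf_valued \<BB>))) \<and>
         ((\<forall>L\<in>Vplus \<Lambda>. \<forall>p\<ge>1. exp_stable p L (Linf_valued \<BB>)) \<longrightarrow>
            (\<exists>p\<ge>1. exp_stable p \<Lambda> (Linf_valued \<BB>))) \<and>
         ((\<chi> j. 1) \<in> Vset \<Lambda> \<longrightarrow>
            ((\<exists>p\<ge>1. exp_stable p \<Lambda> (Linf_valued \<BB>)) \<longrightarrow> mu_HS nrm \<Lambda> \<BB> < 1) \<and>
            (\<forall>p\<ge>1. lyap_exp p \<Lambda> (Linf_valued \<BB>) =
               (INF \<nu>\<in>{\<nu>::real. mu_HS nrm \<Lambda> (shifted \<Lambda> \<nu> \<BB>) < 1}. ereal \<nu>)))"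
proof (intro conjI impI)
  have pos: "\<And>j. 0 < \<Lambda> $ j" using assms(2) by blast
  have shifted_0: "shifted \<Lambda> 0 \<BB> = \<BB>" by (simp add: shifted_def)
  show "\<forall>L\<in>Vplus \<Lambda>. \<forall>p\<ge>1. exp_stable p L (Linf_valued \<BB>)" if mu: "mu_HS nrm \<Lambda> \<BB> < 1"
  proof (intro ballI allI impI)
    fix L and p :: ennreal assume "L \<in> Vplus \<Lambda>" and p: "1 \<le> p"
    then have L: "L \<in> Vset \<Lambda>" "\<And>j. 0 < L $ j" by (auto simp: Vplus_def)
    obtain C \<rho> where C: "0 < C" "0 < \<rho>" "\<rho> < 1"
      "\<And>B n r. \<forall>s. B s \<in> \<BB> \<Longrightarrow> norm (coef \<Lambda> B n r) \<le> C * \<rho> ^ n * exp (0 * r)"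
      using coef_bound_of_mu_HS[OF assms(1) pos assms(4), of 0] mu shifted_0 by metis
    have "exp_type p L (Linf_valued \<BB>) (0 + ln \<rho> / vmax L)"
      using C(4) by (intro exp_type_of_coef_bound[OF L assms(4) p C(1-3)]) simp
    moreover have "0 + ln \<rho> / vmax L < 0" using C vmax_pos[OF L(2)] by (simp add: divide_neg_pos)
    ultimately show "exp_stable p L (Linf_valued \<BB>)" unfolding exp_stable_def by blast
  qed
  show "\<exists>p\<ge>1. exp_stable p \<Lambda> (Linf_valued \<BB>)" if "\<forall>L\<in>Vplus \<Lambda>. \<forall>p\<ge>1. exp_stable p L (Linf_valued \<BB>)"
    using that pos self_mem_Vset by (intro exI[of _ 1]) (auto simp: Vplus_def)
  assume ones: "(\<chi> j. 1) \<in> Vset \<Lambda>"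
  show "mu_HS nrm \<Lambda> \<BB> < 1" if stable: "\<exists>p\<ge>1. exp_stable p \<Lambda> (Linf_valued \<BB>)"
  proof -
    obtain p \<gamma> where p: "1 \<le> p" and \<gamma>: "\<gamma> < 0" "exp_type p \<Lambda> (Linf_valued \<BB>) \<gamma>"
      using stable by (auto simp: exp_stable_def)
    \<comment> \<open>With this tolerance the rate is \<open>\<gamma> / 2\<close>, still negative,
      so the growth lemma applies with \<open>\<nu> = 0\<close>.\<close>
    have "0 < - \<gamma> / 2" using \<gamma> by simp
    then obtain K where K: "0 < K" "\<forall>A\<in>Linf_valued \<BB>. \<forall>u0\<in>Xspace p \<Lambda>. \<forall>u. is_solution \<Lambda> A u0 u \<longrightarrow>
        (\<forall>t\<ge>0. Xnorm p \<Lambda> (history u t) \<le> ennreal (K * exp ((\<gamma> + - \<gamma> / 2) * t)) * Xnorm p \<Lambda> u0)"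
      using \<gamma>(2) unfolding exp_type_def by blast
    have "mu_HS nrm \<Lambda> (shifted \<Lambda> 0 \<BB>) < 1"
    proof (rule mu_HS_less_1_of_growth[OF assms(1) pos ones assms(3) p K(1), where T = 0 and \<nu>' = "\<gamma> + - \<gamma> / 2"])
      fix A u0 u and t :: real
      assume *: "A \<in> Linf_valued \<BB>" "u0 \<in> Xspace p \<Lambda>" and X1: "Xnorm p \<Lambda> u0 = 1"
        and **: "is_solution \<Lambda> A u0 u" "0 \<le> t"
      show "Xnorm p \<Lambda> (history u t) \<le> ennreal (K * exp ((\<gamma> + - \<gamma> / 2) * t))"
        using K(2)[rule_format, OF * **] unfolding X1 by simp
    qed (use \<gamma> in simp)
    then show ?thesis by (simp only: shifted_0)
  qed
  show "\<forall>p\<ge>1. lyap_exp p \<Lambda> (Linf_valued \<BB>) = (INF \<nu>\<in>{\<nu>::real. mu_HS nrm \<Lambda> (shifted \<Lambda> \<nu> \<BB>) < 1}. ereal \<nu>)"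
  proof (intro allI impI antisym)
    fix p :: ennreal assume p: "1 \<le> p"
    show "lyap_exp p \<Lambda> (Linf_valued \<BB>) \<le> (INF \<nu>\<in>{\<nu>::real. mu_HS nrm \<Lambda> (shifted \<Lambda> \<nu> \<BB>) < 1}. ereal \<nu>)"
    proof (rule INF_greatest)
      fix \<nu> assume "\<nu> \<in> {\<nu>. mu_HS nrm \<Lambda> (shifted \<Lambda> \<nu> \<BB>) < 1}"
      then have "mu_HS nrm \<Lambda> (shifted \<Lambda> \<nu> \<BB>) < 1" by simp
      then obtain C \<rho> where C: "0 < C" "0 < \<rho>" "\<rho> < 1"
        "\<And>B n r. \<forall>s. B s \<in> \<BB> \<Longrightarrow> norm (coef \<Lambda> B n r) \<le> C * \<rho> ^ n * exp (\<nu> * r)"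
        using coef_bound_of_mu_HS[OF assms(1) pos assms(4)] by metis
      have "exp_type p \<Lambda> (Linf_valued \<BB>) (\<nu> + ln \<rho> / vmax \<Lambda>)"
        using C(4) by (intro exp_type_of_coef_bound[OF self_mem_Vset pos assms(4) p C(1-3)]) (simp add: transfer_self)
      then have "lyap_exp p \<Lambda> (Linf_valued \<BB>) \<le> ereal (\<nu> + ln \<rho> / vmax \<Lambda>)" by (rule lyap_exp_le)
      also have "\<dots> \<le> ereal \<nu>" using C vmax_pos[OF pos] by (simp add: divide_le_0_iff)
      finally show "lyap_exp p \<Lambda> (Linf_valued \<BB>) \<le> ereal \<nu>" .
    qed
    show "(INF \<nu>\<in>{\<nu>::real. mu_HS nrm \<Lambda> (shifted \<Lambda> \<nu> \<BB>) < 1}. ereal \<nu>) \<le> lyap_exp p \<Lambda> (Linf_valued \<BB>)"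
    proof (rule dense_ge)
      fix y assume "lyap_exp p \<Lambda> (Linf_valued \<BB>) < y"
      then obtain \<nu> where \<nu>: "lyap_exp p \<Lambda> (Linf_valued \<BB>) < ereal \<nu>" "ereal \<nu> < y" using ereal_dense2 by blast
      \<comment> \<open>Growth at rate \<open>\<nu>'\<close> and the shift by the larger
        \<open>\<nu>\<close> leave the strict gap needed for geometric decay.\<close>
      obtain \<nu>' where \<nu>': "lyap_exp p \<Lambda> (Linf_valued \<BB>) < ereal \<nu>'" "ereal \<nu>' < ereal \<nu>"
        using ereal_dense2[OF \<nu>(1)] by blast
      have "eventually (\<lambda>t::real. (SUP A\<in>Linf_valued \<BB>.
          SUP u\<in>{u. \<exists>u0\<in>Xspace p \<Lambda>. Xnorm p \<Lambda> u0 = 1 \<and> is_solution \<Lambda> A u0 u}.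
            ln_ext (Xnorm p \<Lambda> (history u t)) / ereal t) < ereal \<nu>') at_top"
        using \<nu>'(1) unfolding lyap_exp_def by (rule Limsup_lessD)
      then obtain T where T: "\<forall>t\<ge>T. (SUP A\<in>Linf_valued \<BB>.
          SUP u\<in>{u. \<exists>u0\<in>Xspace p \<Lambda>. Xnorm p \<Lambda> u0 = 1 \<and> is_solution \<Lambda> A u0 u}.
            ln_ext (Xnorm p \<Lambda> (history u t)) / ereal t) < ereal \<nu>'"
        unfolding eventually_at_top_linorder by (elim exE)
      have "mu_HS nrm \<Lambda> (shifted \<Lambda> \<nu> \<BB>) < 1"
      proof (rule mu_HS_less_1_of_growth[OF assms(1) pos ones assms(3) p zero_less_one,
            \<comment> \<open>The maximum with 1 keeps \<open>t\<close> positive, so the division by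
              \<open>t\<close> can be undone.\<close>
            where T = "max 1 T" and \<nu>' = \<nu>'])
        fix A u0 u t
        assume A: "A \<in> Linf_valued \<BB>" and u0: "u0 \<in> Xspace p \<Lambda>" "Xnorm p \<Lambda> u0 = 1"
          "is_solution \<Lambda> A u0 u" and t: "max 1 T \<le> t"
        have "ln_ext (Xnorm p \<Lambda> (history u t)) / ereal t \<le> (SUP A\<in>Linf_valued \<BB>.
          SUP u\<in>{u. \<exists>u0\<in>Xspace p \<Lambda>. Xnorm p \<Lambda> u0 = 1 \<and> is_solution \<Lambda> A u0 u}.
            ln_ext (Xnorm p \<Lambda> (history u t)) / ereal t)"
          by (rule SUP_upper2[OF A], rule SUP_upper) (use u0 in blast)
        also have "\<dots> < ereal \<nu>'" using T t by simp
        finally have "Xnorm p \<Lambda> (history u t) \<le> ennreal (exp (\<nu>' * t))"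
          using t by (intro le_exp_of_ln_ext_less) auto
        then show "Xnorm p \<Lambda> (history u t) \<le> ennreal (1 * exp (\<nu>' * t))" by simp
      qed (use \<nu>' in simp)
      then have "(INF \<nu>\<in>{\<nu>::real. mu_HS nrm \<Lambda> (shifted \<Lambda> \<nu> \<BB>) < 1}. ereal \<nu>) \<le> ereal \<nu>"
        by (intro INF_lower) simp
      also have "\<dots> \<le> y" using \<nu>(2) by simp
      finally show "(INF \<nu>\<in>{\<nu>::real. mu_HS nrm \<Lambda> (shifted \<Lambda> \<nu> \<BB>) < 1}. ereal \<nu>) \<le> y" .
    qed
  qed
qed

end
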